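(* Let $C\subseteq\mathbb R$ be homeomorphic to the Cantor space and algebraically independent over $\mathbb Q$, and identify $\overline{\mathbb N}^{\uparrow\mathbb N}$ with $C$ via a fixed homeomorphism. Assume that $\mathfrak d$ is regular. Then there are an ultrafilter $\mathcal U$ with $\mathfrak b(\mathcal U)=\mathfrak d$ and a $\mathfrak b(\mathcal U)$-scale $S=\{f_\alpha:\alpha<\mathfrak d\}$ such that, for $X=S\cup Q\subseteq\overline{\mathbb N}^{\uparrow\mathbb N}=C\subseteq\mathbb R$, all finite powers of $X$ satisfy $\mathbf B(\mathcal U)$, $X$ does not have the Hurewicz property, and, moreover, all finite powers of $\mathbb Q(X)$ have the Menger property, but $\mathbb Q(X)$ does not have the Hurewicz property. Here $\mathbb Q(X)$ is the subfield of $\mathbb R$ generated by $\mathbb Q\cup X$.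
   Context: $\mathbb N=\{0,1,2,\dots\}$, discrete; $\mathbb N^{\mathbb N}$ has the product topology. $[\mathbb N]^{\aleph_0}$ is the family of infinite subsets of $\mathbb N$; $A\subseteq^*B$ means $A\setminus B$ is finite. A semifilter is a nonempty $\mathcal F\subseteq[\mathbb N]^{\aleph_0}$ such that $A\in\mathcal F$, $B\subseteq\mathbb N$ and $A\subseteq^*B$ imply $B\in\mathcal F$. A filter is a semifilter closed under finite intersections; an ultrafilter is a maximal filter (hence nonprincipal). For $f,g\in\mathbb N^{\mathbb N}$, $f\le_{\mathcal F}g$ means $\{n:f(n)\le g(n)\}\in\mathcal F$, and $f\le^*g$ means $f(n)\le g(n)$ for all but finitely many $n$. A set $Y\subseteq\mathbb N^{\mathbb N}$ is bounded with respect to such a relation $R$ if there is $g\in\mathbb N^{\mathbb N}$ with $f\,R\,g$ for all $f\in Y$; otherwise it is unbounded. $\mathfrak b(\mathcal F)$ is the minimal cardinality of a subset of $\mathbb N^{\mathbb N}$ unbounded with respect to $\le_{\mathcal F}$. A set $D\subseteq\mathbb N^{\mathbb N}$ is dominating if each $g\in\mathbb N^{\mathbb N}$ satisfies $g\le^*f$ for some $f\in D$; $\mathfrak d$ is the minimal cardinality of a dominating set. A space satisfies $\mathbf B(\mathcal F)$ if each of its continuous images in $\mathbb N^{\mathbb N}$ is bounded with respect to $\le_{\mathcal F}$; it has the Menger property if no continuous image of it in $\mathbb N^{\mathbb N}$ is dominating (equivalently, it satisfies $\mathbf B([\mathbb N]^{\aleph_0})$); it has the Hurewicz property if each of its continuous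 images in $\mathbb N^{\mathbb N}$ is bounded with respect to $\le^*$. $\mathbb N^{\uparrow\mathbb N}$ is the set of (strictly) increasing elements of $\mathbb N^{\mathbb N}$. A $\mathfrak b(\mathcal F)$-scale is a family $S=\{f_\alpha:\alpha<\mathfrak b(\mathcal F)\}\subseteq\mathbb N^{\uparrow\mathbb N}$ that is unbounded with respect to $\le_{\mathcal F}$ and satisfies $f_\alpha\le_{\mathcal F}f_\beta$ for all $\alpha<\beta<\mathfrak b(\mathcal F)$. $\overline{\mathbb N}=\mathbb N\cup\{\infty\}$ is the one-point compactification of $\mathbb N$. $\overline{\mathbb N}^{\uparrow\mathbb N}$ is the subspace of the product $\overline{\mathbb N}^{\mathbb N}$ consisting of the nondecreasing $f$ such that $f(n)<f(n+1)$ whenever $f(n)<\infty$; it is homeomorphic to the Cantor space. $Q$ (not to be confused with the rationals $\mathbb Q$) is the countable set of all $f\in\overline{\mathbb N}^{\uparrow\mathbb N}$ that take the value $\infty$; thus $\overline{\mathbb N}^{\uparrow\mathbb N}=Q\cup\mathbb N^{\uparrow\mathbb N}$. A set $C$ as in the claim exists by a classical theorem of von Neumann. *)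

theory Defs
  imports "HOL-Analysis.Analysis" "HOL-Library.Poly_Mapping"
begin

unbundle cardinal_syntax
no_notation elt_set_eq (infix \<open>=o\<close> 50)

section \<open>Semifilters and relations on the Baire space\<close>

definition almost_subset :: "nat set \<Rightarrow> nat set \<Rightarrow> bool" where
  "almost_subset A B \<longleftrightarrow> finite (A - B)"

definition semifilter :: "nat set set \<Rightarrow> bool" where
  "semifilter F \<longleftrightarrow> F \<noteq> {} \<and> (\<forall>A\<in>F. infinite A) \<and>
     (\<forall>A\<in>F. \<forall>B. almost_subset A B \<longrightarrow> B \<in> F)"

definition free_filter :: "nat set set \<Rightarrow> bool" where
  "free_filter F \<longleftrightarrow> semifilter F \<and> (\<forall>A\<in>F. \<forall>B\<in>F. A \<inter> B \<in> F)"

definition free_ultrafilter :: "nat set set \<Rightarrow> bool" where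
  "free_ultrafilter U \<longleftrightarrow> free_filter U \<and> (\<forall>F. free_filter F \<and> U \<subseteq> F \<longrightarrow> F = U)"

definition le_mod :: "nat set set \<Rightarrow> (nat \<Rightarrow> nat) \<Rightarrow> (nat \<Rightarrow> nat) \<Rightarrow> bool" where
  "le_mod F f g \<longleftrightarrow> {n. f n \<le> g n} \<in> F"

definition le_star :: "(nat \<Rightarrow> nat) \<Rightarrow> (nat \<Rightarrow> nat) \<Rightarrow> bool" where
  "le_star f g \<longleftrightarrow> (MOST n. f n \<le> g n)"

definition bounded_wrt ::
    "((nat \<Rightarrow> nat) \<Rightarrow> (nat \<Rightarrow> nat) \<Rightarrow> bool) \<Rightarrow> (nat \<Rightarrow> nat) set \<Rightarrow> bool" where
  "bounded_wrt R Y \<longleftrightarrow> (\<exists>g. \<forall>f\<in>Y. R f g)"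

definition dominating :: "(nat \<Rightarrow> nat) set \<Rightarrow> bool" where
  "dominating D \<longleftrightarrow> (\<forall>g. \<exists>f\<in>D. le_star g f)"

section \<open>Cardinal characteristics\<close>

text \<open>
  Cardinals are the minimal well-orders of the HOL cardinal library, considered up to
  order isomorphism. In particular the well-order \<open>min_card \<AA>\<close> lives on a member of \<open>\<AA>\<close>
  of least cardinality; which member is chosen is irrelevant.
\<close>

definition min_card :: "'a set set \<Rightarrow> 'a rel" where
  "min_card \<AA> = |SOME A. A \<in> \<AA> \<and> (\<forall>B\<in>\<AA>. |A| \<le>o |B| )|"

lemma min_card_attained:
  assumes "\<AA> \<noteq> {}"
  shows "\<exists>A\<in>\<AA>. min_card \<AA> = |A| \<and> (\<forall>B\<in>\<AA>. |A| \<le>o |B| )"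
proof -
  from assms obtain A0 where "A0 \<in> \<AA>" by auto
  have "wf (inv_image ordLess card_of :: 'a set rel)"
    by (rule wf_inv_image[OF wf_ordLess])
  then have "\<exists>A\<in>\<AA>. \<forall>B. (B, A) \<in> inv_image ordLess card_of \<longrightarrow> B \<notin> \<AA>"
    using \<open>A0 \<in> \<AA>\<close> unfolding wf_eq_minimal by meson
  then obtain A where A: "A \<in> \<AA>" and min: "\<forall>B. |B| <o |A| \<longrightarrow> B \<notin> \<AA>"
    unfolding in_inv_image by (rule bexE)
  have le: "|A| \<le>o |B|" if "B \<in> \<AA>" for B
  proof -
    have "\<not> |B| <o |A|" using min that by meson
    then show ?thesis
      using ordLess_or_ordLeq[OF card_of_Well_order card_of_Well_order, of B A] by simp
  qed
  let ?P = "\<lambda>A. A \<in> \<AA> \<and> (\<forall>B\<in>\<AA>. |A| \<le>o |B| )"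
  have "?P A" using A le by simp
  then have "?P (Eps ?P)" by (rule someI[of ?P])
  then show ?thesis
    unfolding min_card_def by (intro bexI[of _ "Eps ?P"]) simp_all
qed

definition card_b :: "nat set set \<Rightarrow> (nat \<Rightarrow> nat) rel" where
  "card_b F = min_card {Y. \<not> bounded_wrt (le_mod F) Y}"

definition card_d :: "(nat \<Rightarrow> nat) rel" where
  "card_d = min_card {D. dominating D}"

text \<open>
  \<open>b_scale F r f\<close>: the family \<open>f\<close>, restricted to the field of \<open>r\<close>, is a \<open>card_b F\<close>-scale.
  The index set may be any cardinal \<open>r\<close> that is equal, that is, order isomorphic to
  \<open>card_b F\<close>; its elements play the role of the ordinals below that cardinal.
\<close>

definition b_scale :: "nat set set \<Rightarrow> 'i rel \<Rightarrow> ('i \<Rightarrow> nat \<Rightarrow> nat) \<Rightarrow> bool" where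
  "b_scale F r f \<longleftrightarrow> r =o card_b F \<and>
     (\<forall>\<alpha>\<in>Field r. strict_mono (f \<alpha>)) \<and>
     \<not> bounded_wrt (le_mod F) (f ` Field r) \<and>
     (\<forall>\<alpha> \<beta>. (\<alpha>, \<beta>) \<in> r \<and> \<alpha> \<noteq> \<beta> \<longrightarrow> le_mod F (f \<alpha>) (f \<beta>))"

section \<open>Selection properties\<close>

text \<open>
  The topology \<open>euclidean\<close> on \<^typ>\<open>nat \<Rightarrow> nat\<close> is the product of discrete topologies.
\<close>

definition satisfies_B :: "nat set set \<Rightarrow> 'a topology \<Rightarrow> bool" where
  "satisfies_B F T \<longleftrightarrow>
     (\<forall>\<phi>. continuous_map T (euclidean :: (nat \<Rightarrow> nat) topology) \<phi> \<longrightarrow>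
        bounded_wrt (le_mod F) (\<phi> ` topspace T))"

definition Menger :: "'a topology \<Rightarrow> bool" where
  "Menger T \<longleftrightarrow>
     (\<forall>\<phi>. continuous_map T (euclidean :: (nat \<Rightarrow> nat) topology) \<phi> \<longrightarrow>
        \<not> dominating (\<phi> ` topspace T))"

definition Hurewicz :: "'a topology \<Rightarrow> bool" where
  "Hurewicz T \<longleftrightarrow>
     (\<forall>\<phi>. continuous_map T (euclidean :: (nat \<Rightarrow> nat) topology) \<phi> \<longrightarrow>
        bounded_wrt le_star (\<phi> ` topspace T))"

definition finite_power :: "'a topology \<Rightarrow> nat \<Rightarrow> (nat \<Rightarrow> 'a) topology" where
  "finite_power T k = product_topology (\<lambda>_. T) {..<k}"

section \<open>Increasing sequences of extended natural numbers\<close>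

text \<open>
  The order topology on \<^typ>\<open>enat\<close> is that of the one-point compactification of the
  discrete natural numbers (see \<open>open_enat_iff\<close>), and \<^typ>\<open>nat \<Rightarrow> enat\<close> carries the
  product topology.
\<close>

definition enat_incr :: "(nat \<Rightarrow> enat) set" where
  "enat_incr = {f. mono f \<and> (\<forall>n. f n < \<infinity> \<longrightarrow> f n < f (Suc n))}"

definition Q_set :: "(nat \<Rightarrow> enat) set" where
  "Q_set = {f \<in> enat_incr. \<exists>n. f n = \<infinity>}"

definition enat_seq :: "(nat \<Rightarrow> nat) \<Rightarrow> nat \<Rightarrow> enat" where
  "enat_seq f = (\<lambda>n. enat (f n))"

section \<open>Algebraic independence and generated subfields\<close>

text \<open>
  Polynomials over the rationals in indeterminates indexed by the real numbers are elements
  of \<^typ>\<open>(real \<Rightarrow>\<^sub>0 nat) \<Rightarrow>\<^sub>0 rat\<close>: they map monomials (exponent vectors) to coefficients.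
  Evaluation substitutes each real number for the indeterminate that it indexes.
\<close>

definition eval_rat_poly :: "((real \<Rightarrow>\<^sub>0 nat) \<Rightarrow>\<^sub>0 rat) \<Rightarrow> real" where
  "eval_rat_poly p =
     (\<Sum>m\<in>Poly_Mapping.keys p. of_rat (poly_mapping.lookup p m) *
        (\<Prod>x\<in>Poly_Mapping.keys m. x ^ poly_mapping.lookup m x))"

definition alg_independent_rat :: "real set \<Rightarrow> bool" where
  "alg_independent_rat C \<longleftrightarrow>
     (\<forall>p. (\<forall>m\<in>Poly_Mapping.keys p. Poly_Mapping.keys m \<subseteq> C) \<and>
        eval_rat_poly p = 0 \<longrightarrow> p = 0)"

definition real_subfield :: "real set \<Rightarrow> bool" where
  "real_subfield K \<longleftrightarrow> 0 \<in> K \<and> 1 \<in> K \<and>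
     (\<forall>x\<in>K. \<forall>y\<in>K. x + y \<in> K \<and> x * y \<in> K) \<and>
     (\<forall>x\<in>K. - x \<in> K) \<and> (\<forall>x\<in>K. x \<noteq> 0 \<longrightarrow> inverse x \<in> K)"

definition rat_adjoin :: "real set \<Rightarrow> real set" where
  "rat_adjoin X = real_subfield hull (\<rat> \<union> X)"

end

theory Submission
  imports Defs
begin

text \<open>
  The ultrafilter and the scale are built in one transfinite recursion of length \<open>\<dd>\<close>, indexed by a
  dominating family of minimal size. At each stage fewer than \<open>\<dd>\<close> sets and functions have to be
  respected, so some function is not dominated by the ones they induce; it keeps the sets
  \<open>{n. u n \<le> f n}\<close> centered with the earlier ones. Regularity of \<open>\<dd>\<close> then gives \<open>\<bb>(\<U>) = \<dd>\<close>.
  Moreover \<open>f\<^sub>\<alpha>\<close> can be given long intervals in its range, on a union of blocks of indices whose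
  complement is added to the centered family, while its range stays co-infinite.

  A continuous map on a power of \<open>X\<close> is bounded near the compact sets \<open>{f. f n = \<infinity>} \<subseteq> Q\<close>, hence on all
  points with late coordinates in the scale; the other points lie on fewer than \<open>\<dd> = \<bb>(\<U>)\<close>
  slices of smaller dimension. The field \<open>\<rat>(X)\<close> arises from \<open>X\<close> by countably many continuous
  operations on closed subsets of powers.

  The first number \<open>\<ge> n\<close> outside the range of \<open>f\<close> depends continuously on \<open>f \<in> X\<close> and is unbounded
  because of the long intervals. By algebraic independence \<open>\<rat>(X) \<inter> C = X\<close>, and some
  \<open>c \<in> C\<close> lies outside \<open>\<rat>(X)\<close>; cutting the line at the points \<open>c + i / 2\<^sup>j\<close> yields clopen
  partitions of \<open>\<rat>(X)\<close> along which this function is extended.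
\<close>

section \<open>Centered families and ultrafilters\<close>

text \<open>The strong finite intersection property. Asking for infinite rather than nonempty
  intersections makes the maximal centered families free.\<close>

definition centered :: "nat set set \<Rightarrow> bool" where
  "centered A \<longleftrightarrow> (\<forall>B. finite B \<and> B \<subseteq> A \<longrightarrow> infinite (\<Inter>B))"

text \<open>Up to a finite set, each finite intersection from \<open>B\<close> contains a finite
  intersection from \<open>A\<close>, and the latter is infinite.\<close>

lemma centered_refine:
  assumes A: "centered A"
    and B: "\<And>b. b \<in> B \<Longrightarrow> \<exists>C. finite C \<and> C \<subseteq> A \<and> almost_subset (\<Inter>C) b"
  shows "centered B"
  unfolding centered_def
proof (intro allI impI)
  fix F assume F: "finite F \<and> F \<subseteq> B"
  have "\<forall>b\<in>F. \<exists>C. finite C \<and> C \<subseteq> A \<and> almost_subset (\<Inter>C) b"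
    using B F by blast
  then obtain C where C: "\<And>b. b \<in> F \<Longrightarrow> finite (C b) \<and> C b \<subseteq> A \<and> almost_subset (\<Inter>(C b)) b"
    by metis
  have "finite (\<Union>(C ` F))" "\<Union>(C ` F) \<subseteq> A"
    using C F by auto
  then have inf: "infinite (\<Inter>(\<Union>(C ` F)))"
    using A unfolding centered_def by blast
  have "\<Inter>(\<Union>(C ` F)) \<subseteq> \<Inter>F \<union> (\<Union>b\<in>F. \<Inter>(C b) - b)"
    by auto
  moreover have "finite (\<Union>b\<in>F. \<Inter>(C b) - b)"
    using F C unfolding almost_subset_def by auto
  ultimately show "infinite (\<Inter>F)"
    using inf by (meson finite_Un finite_subset)
qed

text \<open>If finite \<open>F\<close> and \<open>G\<close> witness both failures, drop
  \<open>E\<close> from \<open>F\<close> and \<open>- E\<close> from \<open>G\<close>. What remains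
  comes from \<open>A\<close>, and each point of its intersection lies in the intersection of
  \<open>F\<close> or of \<open>G\<close>, according to whether it lies in \<open>E\<close>.\<close>

lemma centered_insert_or_Compl:
  assumes "centered A"
  shows "centered (insert E A) \<or> centered (insert (- E) A)"
proof (rule ccontr)
  assume "\<not> ?thesis"
  then obtain F G where F: "finite F" "F \<subseteq> insert E A" "finite (\<Inter>F)"
    and G: "finite G" "G \<subseteq> insert (- E) A" "finite (\<Inter>G)"
    unfolding centered_def by auto
  let ?H = "(F - {E}) \<union> (G - {- E})"
  have "infinite (\<Inter>?H)"
    using assms F G unfolding centered_def by (metis Diff_subset_conv Un_least finite_Diff finite_Un insert_is_Un)
  moreover have "\<Inter>?H \<subseteq> \<Inter>F \<union> \<Inter>G"
    by blast
  ultimately show False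
    using F G by (meson finite_Un finite_subset)
qed

lemma centered_Union_chain:
  assumes "\<And>F. finite F \<Longrightarrow> F \<subseteq> \<Union>\<C> \<Longrightarrow> \<exists>A\<in>\<C>. F \<subseteq> A" and "\<And>A. A \<in> \<C> \<Longrightarrow> centered A"
  shows "centered (\<Union>\<C>)"
  using assms unfolding centered_def by metis

lemma free_filter_imp_centered:
  assumes "free_filter F"
  shows "centered F"
proof -
  have "\<Inter>B \<in> F" if "finite B" "B \<subseteq> F" for B
    using that
  proof (induction B)
    case empty
    obtain A where "A \<in> F" using assms by (auto simp: free_filter_def semifilter_def)
    have "almost_subset A UNIV" by (simp add: almost_subset_def)
    then show ?case
      using assms \<open>A \<in> F\<close> unfolding free_filter_def semifilter_def by simp
  next
    case (insert b B)
    then show ?case using assms by (auto simp: free_filter_def)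
  qed
  then show ?thesis
    using assms unfolding centered_def by (auto simp: free_filter_def semifilter_def)
qed

text \<open>By \<open>centered_refine\<close> adjoining \<open>B\<close> keeps \<open>U\<close>
  centered, so maximality applies.\<close>

lemma maximal_centered_member:
  assumes "centered U" and max: "\<And>V. centered V \<Longrightarrow> U \<subseteq> V \<Longrightarrow> V = U"
    and "finite C" "C \<subseteq> U" "almost_subset (\<Inter>C) B"
  shows "B \<in> U"
proof -
  have "centered (insert B U)"
  proof (rule centered_refine[OF assms(1)])
    fix b assume "b \<in> insert B U"
    then show "\<exists>C. finite C \<and> C \<subseteq> U \<and> almost_subset (\<Inter>C) b"
    proof
      assume "b \<in> U"
      then show ?thesis
        by (intro exI[of _ "{b}"]) (auto simp: almost_subset_def)
    qed (use assms in blast)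
  qed
  then show ?thesis
    using max[of "insert B U"] by blast
qed

lemma maximal_centered_imp_free_ultrafilter:
  assumes cen: "centered U" and max: "\<And>V. centered V \<Longrightarrow> U \<subseteq> V \<Longrightarrow> V = U"
  shows "free_ultrafilter U"
proof -
  note mem = maximal_centered_member[OF assms]
  have "UNIV \<in> U"
    using mem[of "{}" UNIV] by (simp add: almost_subset_def)
  moreover have "infinite A" if "A \<in> U" for A
    using cen that unfolding centered_def by (metis cInf_singleton empty_subsetI finite.emptyI finite_insert insert_subset)
  moreover have "B \<in> U" if "A \<in> U" "almost_subset A B" for A B
    using mem[of "{A}" B] that by simp
  moreover have "A \<inter> B \<in> U" if "A \<in> U" "B \<in> U" for A B
    using mem[of "{A, B}" "A \<inter> B"] that by (simp add: almost_subset_def)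
  ultimately have "free_filter U"
    unfolding free_filter_def semifilter_def by blast
  then show ?thesis
    using free_filter_imp_centered max unfolding free_ultrafilter_def by blast
qed

text \<open>Zorn's lemma is applied to centered families. The dichotomy between \<open>B\<close> and
  \<open>- B\<close> is recorded because \<open>free_ultrafilter\<close> is defined through
  maximality among filters.\<close>

lemma centered_extends_to_free_ultrafilter:
  assumes "centered A"
  obtains U where "A \<subseteq> U" "free_ultrafilter U"
    "\<forall>B. B \<in> U \<or> - B \<in> U"
proof -
  have "\<exists>M\<in>{V. A \<subseteq> V \<and> centered V}. \<forall>X\<in>{V. A \<subseteq> V \<and> centered V}. M \<subseteq> X \<longrightarrow> X = M"
  proof (rule subset_Zorn_nonempty)
    fix \<C> assume "\<C> \<noteq> {}" and ch: "subset.chain {V. A \<subseteq> V \<and> centered V} \<C>"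
    have "centered (\<Union>\<C>)"
    proof (rule centered_Union_chain)
      show "\<exists>B\<in>\<C>. F \<subseteq> B" if "finite F" "F \<subseteq> \<Union>\<C>" for F
        using finite_subset_Union_chain[OF that \<open>\<C> \<noteq> {}\<close> ch] by metis
      show "centered B" if "B \<in> \<C>" for B
        using ch that unfolding subset.chain_def by auto
    qed
    then show "\<Union>\<C> \<in> {V. A \<subseteq> V \<and> centered V}"
      using ch \<open>\<C> \<noteq> {}\<close> by (auto 0 3 simp: subset.chain_def subset_iff)
  qed (use assms in auto)
  then obtain U where "U \<in> {V. A \<subseteq> V \<and> centered V}"
    and max': "\<forall>V\<in>{V. A \<subseteq> V \<and> centered V}. U \<subseteq> V \<longrightarrow> V = U"
    by (rule bexE)
  then have U: "A \<subseteq> U" "centered U"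
    by simp_all
  have max: "\<And>V. centered V \<Longrightarrow> U \<subseteq> V \<Longrightarrow> V = U"
    using max' U(1) by auto
  show ?thesis
  proof
    show "\<forall>B. B \<in> U \<or> - B \<in> U"
      using centered_insert_or_Compl[OF U(2)] max by blast
  qed (use U maximal_centered_imp_free_ultrafilter[OF U(2) max] in auto)
qed

lemma free_filter_Int: "free_filter U \<Longrightarrow> A \<in> U \<Longrightarrow> B \<in> U \<Longrightarrow> A \<inter> B \<in> U"
  by (simp add: free_filter_def)

lemma free_filter_almost_superset:
  "free_filter U \<Longrightarrow> A \<in> U \<Longrightarrow> finite (A - B) \<Longrightarrow> B \<in> U"
  unfolding free_filter_def semifilter_def almost_subset_def by blast

lemma free_filter_superset: "free_filter U \<Longrightarrow> A \<in> U \<Longrightarrow> A \<subseteq> B \<Longrightarrow> B \<in> U"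
  by (rule free_filter_almost_superset[of U A]) (auto simp: Diff_eq_empty_iff[THEN iffD2])

lemma free_filter_cofinite: "free_filter U \<Longrightarrow> finite (- B) \<Longrightarrow> B \<in> U"
proof -
  assume U: "free_filter U" and B: "finite (- B)"
  obtain A where "A \<in> U"
    using U by (auto simp: free_filter_def semifilter_def)
  then show ?thesis
    using free_filter_almost_superset[OF U] B by (metis Diff_eq finite_Int)
qed

lemma free_filter_Ball_finite:
  assumes "free_filter U" "finite I" "\<And>i. i \<in> I \<Longrightarrow> {n. P i n} \<in> U"
  shows "{n. \<forall>i\<in>I. P i n} \<in> U"
  using assms(2,3)
proof (induction I)
  case empty
  then show ?case using free_filter_cofinite[OF assms(1)] by simp
next
  case (insert i I)
  then have "{n. P i n} \<inter> {n. \<forall>i\<in>I. P i n} \<in> U"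
    using free_filter_Int[OF assms(1)] by simp
  then show ?case by (rule back_subst[of "\<lambda>A. A \<in> U"]) auto
qed

lemma le_mod_trans:
  "free_filter U \<Longrightarrow> le_mod U f g \<Longrightarrow> le_mod U g k \<Longrightarrow> le_mod U f k"
  unfolding le_mod_def
  by (rule free_filter_superset[of U "{n. f n \<le> g n} \<inter> {n. g n \<le> k n}"])
    (auto intro: free_filter_Int order_trans)

lemma le_star_imp_le_mod: "free_filter U \<Longrightarrow> le_star f g \<Longrightarrow> le_mod U f g"
  unfolding le_mod_def le_star_def
  by (rule free_filter_cofinite) (auto simp: MOST_iff_cofinite Collect_neg_eq[symmetric])

lemma dominating_imp_unbounded_le_mod:
  assumes "free_filter U" "dominating D"
  shows "\<not> bounded_wrt (le_mod U) D"
proof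
  assume "bounded_wrt (le_mod U) D"
  then obtain g where g: "\<And>f. f \<in> D \<Longrightarrow> le_mod U f g"
    unfolding bounded_wrt_def by auto
  obtain f where "f \<in> D" "le_star (Suc \<circ> g) f"
    using assms(2) unfolding dominating_def by auto
  then have "le_mod U (Suc \<circ> g) g"
    using le_mod_trans[OF assms(1) le_star_imp_le_mod[OF assms(1)]] g by blast
  then show False
    using assms(1) by (auto simp: le_mod_def free_filter_def semifilter_def)
qed

lemma satisfies_B_imp_Menger: "free_filter U \<Longrightarrow> satisfies_B U T \<Longrightarrow> Menger T"
  using dominating_imp_unbounded_le_mod unfolding satisfies_B_def Menger_def by blast

section \<open>Families smaller than the dominating number\<close>

lemma countable_not_dominating:
  assumes "countable D"
  shows "\<not> dominating D"
proof
  assume D: "dominating D"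
  then have "D \<noteq> {}" by (auto simp: dominating_def)
  then obtain s :: "nat \<Rightarrow> nat \<Rightarrow> nat" where s: "D = range s"
    using uncountable_def assms by metis
  \<comment> \<open>A diagonal function: for n \<ge> i the sum contains the term
    \<open>s i n\<close>.\<close>
  obtain f where f: "f \<in> D" "le_star (\<lambda>n. Suc (\<Sum>i\<le>n. s i n)) f"
    using D by (auto simp: dominating_def)
  then obtain i where "f = s i" using s by auto
  with f obtain N where N: "\<And>n. n \<ge> N \<Longrightarrow> Suc (\<Sum>i\<le>n. s i n) \<le> s i n"
    unfolding le_star_def MOST_nat_le by auto
  have "s i (max i N) \<le> (\<Sum>j\<le>max i N. s j (max i N))"
    by (rule member_le_sum) auto
  with N[of "max i N"] show False by simp
qed

lemma card_d_dominating:
  obtains D where "dominating D" "card_d = |D|" "\<And>E. dominating E \<Longrightarrow> |D| \<le>o |E|"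
proof -
  have "{D. dominating D} \<noteq> {}"
    by (auto simp: dominating_def le_star_def intro!: exI[of _ UNIV] intro: ALL_MOST)
  from min_card_attained[OF this] show ?thesis
    using that unfolding card_d_def by blast
qed

lemma Card_order_card_d: "Card_order card_d"
  by (metis card_d_dominating card_of_Card_order)

lemma countable_ordLess_card_d:
  assumes "countable A"
  shows "|A| <o card_d"
proof (rule ccontr)
  obtain D where D: "dominating D" "card_d = |D|"
    using card_d_dominating by metis
  assume "\<not> ?thesis"
  then have "|D| \<le>o |A|"
    using D(2) ordLess_or_ordLeq[OF card_of_Well_order card_of_Well_order, of A D] by auto
  then obtain i where "inj_on i D" "i ` D \<subseteq> A"
    using card_of_ordLeq[of D A] by auto
  then have "countable D"
    using assms countable_image_inj_on countable_subset by metis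
  then show False
    using countable_not_dominating D(1) by blast
qed

lemma ordLess_card_d_not_dominating:
  assumes "|E| <o card_d"
  shows "\<not> dominating E"
  using assms by (metis card_d_dominating not_ordLess_ordLeq)

lemma infinite_Field_card_d: "\<not> finite (Field card_d)"
proof
  assume "finite (Field card_d)"
  then have "|Field card_d| <o card_d"
    by (intro countable_ordLess_card_d countable_finite)
  then show False
    using Card_order_card_d card_of_Field_ordIso not_ordLess_ordIso by blast
qed

lemma ordLess_card_d_Un:
  "|A| <o card_d \<Longrightarrow> |B| <o card_d \<Longrightarrow> |A \<union> B| <o card_d"
  by (rule card_of_Un_ordLess_infinite_Field[OF infinite_Field_card_d Card_order_card_d])

lemma ordLess_card_d_image: "|A| <o card_d \<Longrightarrow> |f ` A| <o card_d"
  using card_of_image ordLeq_ordLess_trans by blast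

lemma ordLess_card_d_subset: "|A| <o card_d \<Longrightarrow> B \<subseteq> A \<Longrightarrow> |B| <o card_d"
  using card_of_mono1 ordLeq_ordLess_trans by blast

lemma ordLess_card_d_Times:
  assumes "|A| <o card_d" "|B| <o card_d"
  shows "|A \<times> B| <o card_d"
proof (cases "finite A \<and> finite B")
  case True
  then show ?thesis by (intro countable_ordLess_card_d countable_finite) simp
next
  case False
  then have "|A \<times> B| \<le>o |A <+> B|"
    by (intro card_of_Times_ordLeq_infinite_Field)
      (auto simp: card_of_card_order_on card_of_Plus1 card_of_Plus2 Field_card_of)
  then show ?thesis
    using card_of_Plus_ordLess_infinite_Field[OF infinite_Field_card_d Card_order_card_d assms]
      ordLeq_ordLess_trans by blast
qed

lemma ordLess_card_d_UN:
  assumes "regularCard card_d" "|I| <o card_d" "\<And>i. i \<in> I \<Longrightarrow> |A i| <o card_d"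
  shows "|\<Union>i\<in>I. A i| <o card_d"
  using card_of_UNION_ordLess_infinite_Field[OF regularCard_stable[OF Card_order_card_d
        infinite_Field_card_d assms(1)] Card_order_card_d]
    infinite_Field_card_d assms(2,3) by blast

text \<open>Finite subsets are the sets of finite lists. Lists of a fixed length are counted by
  iterated products, and regularity handles the union over all lengths.\<close>

lemma ordLess_card_d_Fpow:
  assumes reg: "regularCard card_d" and A: "|A| <o card_d"
  shows "|Fpow A| <o card_d"
proof -
  let ?L = "\<lambda>n. {xs. set xs \<subseteq> A \<and> length xs = n}"
  have L: "|?L n| <o card_d" for n
  proof (induction n)
    case 0
    have "?L 0 = {[]}" by auto
    then show ?case by (simp add: countable_ordLess_card_d)
  next
    case (Suc n)
    have "?L (Suc n) = (\<lambda>(x, xs). x # xs) ` (A \<times> ?L n)"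
      by (auto simp: length_Suc_conv)
    then show ?case
      using ordLess_card_d_image[OF ordLess_card_d_Times[OF A Suc.IH]] by simp
  qed
  have "|\<Union>n. ?L n| <o card_d"
    by (intro ordLess_card_d_UN reg L countable_ordLess_card_d) simp
  moreover have "Fpow A \<subseteq> set ` (\<Union>n. ?L n)"
  proof
    fix F assume "F \<in> Fpow A"
    then obtain xs where "set xs = F" "F \<subseteq> A"
      using finite_list by (auto simp: Fpow_def)
    then show "F \<in> set ` (\<Union>n. ?L n)" by auto
  qed
  ultimately show ?thesis
    using ordLess_card_d_image ordLess_card_d_subset by blast
qed

section \<open>Construction of the scale\<close>

lemma not_le_star_iff: "\<not> le_star f g \<longleftrightarrow> (\<forall>k. \<exists>n\<ge>k. g n < f n)"
  unfolding le_star_def MOST_nat_le by (auto simp: not_le)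

text \<open>For finite \<open>B\<close> from \<open>A\<close> and finite \<open>E\<close> from
  \<open>G\<close>, take the sum of \<open>E\<close> evaluated at the next element of the
  intersection of \<open>B\<close>. Fewer than \<open>card_d\<close> functions arise, so a single
  \<open>g\<close> exceeds each of them infinitely often.\<close>

lemma centered_extend_by_function:
  assumes reg: "regularCard card_d" and cen: "centered A"
    and A: "|A| <o card_d" and G: "|G| <o card_d"
  obtains f :: "nat \<Rightarrow> nat" where "centered (A \<union> (\<lambda>u. {n. u n \<le> f n}) ` G)"
proof -
  define nx where "nx B n = (LEAST m. n \<le> m \<and> m \<in> \<Inter>B)" for B :: "nat set set" and n
  define w where "w = (\<lambda>(B, E) n. \<Sum>u\<in>E. u (nx B n) :: nat)"
  have "|w ` (Fpow A \<times> Fpow G)| <o card_d"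
    by (intro ordLess_card_d_image ordLess_card_d_Times ordLess_card_d_Fpow reg A G)
  then obtain g where g: "\<And>B E. B \<in> Fpow A \<Longrightarrow> E \<in> Fpow G \<Longrightarrow> \<not> le_star g (w (B, E))"
    using ordLess_card_d_not_dominating unfolding dominating_def by fastforce
  \<comment> \<open>Cumulative sums make \<open>f\<close> monotone, so that \<open>g n\<close> is
    still a lower bound of \<open>f\<close> at the later point \<open>nx B n\<close>, where the
    functions in \<open>E\<close> are evaluated.\<close>
  define f where "f n = (\<Sum>i\<le>n. g i)" for n
  have f: "g m \<le> f n" if "m \<le> n" for m n
    unfolding f_def using that by (intro member_le_sum) auto
  have "centered (A \<union> (\<lambda>u. {n. u n \<le> f n}) ` G)"
    unfolding centered_def
  proof (intro allI impI)
    fix F assume F: "finite F \<and> F \<subseteq> A \<union> (\<lambda>u. {n. u n \<le> f n}) ` G"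
    define B where "B = F \<inter> A"
    have B: "B \<in> Fpow A" and Binf: "infinite (\<Inter>B)"
      using F cen by (auto simp: B_def Fpow_def centered_def)
    have "finite (F - A)" "F - A \<subseteq> (\<lambda>u. {n. u n \<le> f n}) ` G"
      using F by auto
    from finite_subset_image[OF this] obtain E
      where E: "E \<subseteq> G" "finite E" "F - A = (\<lambda>u. {n. u n \<le> f n}) ` E"
      by (elim bexE exE conjE)
    have "\<exists>m\<ge>k. m \<in> \<Inter>F" for k
    proof -
      have "E \<in> Fpow G" using E by (simp add: Fpow_def)
      from g[OF B this] obtain n where n: "n \<ge> k" "w (B, E) n < g n"
        unfolding not_le_star_iff by blast
      have "\<exists>m. n \<le> m \<and> m \<in> \<Inter>B"
        using Binf by (meson infinite_nat_iff_unbounded_le)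
      then have m: "n \<le> nx B n" "nx B n \<in> \<Inter>B"
        unfolding nx_def by (metis (mono_tags, lifting) LeastI_ex)+
      have "u (nx B n) \<le> f (nx B n)" if "u \<in> E" for u
      proof -
        have "u (nx B n) \<le> w (B, E) n"
          unfolding w_def using E(2) that by (auto intro: member_le_sum)
        also have "\<dots> \<le> g n" using n by simp
        also have "\<dots> \<le> f (nx B n)" using f m by simp
        finally show ?thesis .
      qed
      then have "nx B n \<in> \<Inter>(F - A)"
        unfolding E(3) by auto
      then have "nx B n \<in> \<Inter>F"
        using m(2) unfolding B_def by blast
      then show ?thesis
        using m(1) n(1) order_trans by blast
    qed
    then show "infinite (\<Inter>F)"
      by (meson infinite_nat_iff_unbounded_le)
  qed
  then show ?thesis by (rule that)
qed

section \<open>Increasing functions with runs and gaps in their range\<close>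

lemma block_index:
  fixes a :: "nat \<Rightarrow> nat"
  assumes "strict_mono a" "a 0 = 0"
  shows "\<exists>!k. a k \<le> n \<and> n < a (Suc k)"
proof (rule ex_ex1I)
  have "n < a (Suc n)"
    using strict_mono_imp_increasing[OF assms(1), of "Suc n"] by simp
  then have ex: "\<exists>k. n < a (Suc k)" by blast
  define k where "k = (LEAST k. n < a (Suc k))"
  have "n < a (Suc k)"
    unfolding k_def using ex by (rule LeastI_ex)
  moreover have "a k \<le> n"
  proof (cases k)
    case 0
    then show ?thesis using assms by simp
  next
    case (Suc j)
    then show ?thesis using not_less_Least[of j "\<lambda>k. n < a (Suc k)"] unfolding k_def by simp
  qed
  ultimately show "\<exists>k. a k \<le> n \<and> n < a (Suc k)" by blast
next
  fix k l assume "a k \<le> n \<and> n < a (Suc k)" "a l \<le> n \<and> n < a (Suc l)"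
  then have "a k < a (Suc l)" "a l < a (Suc k)" by auto
  then show "k = l"
    using assms(1) by (simp add: strict_mono_less)
qed

text \<open>
  On the blocks of one parity \<open>f\<close> follows \<open>h\<close>; on the others it grows by one at each step, which produces
  a run in the range and, as \<open>h\<close> grows by at least two, a gap before the next block.
\<close>

lemma exists_function_with_runs:
  fixes g h :: "nat \<Rightarrow> nat"
  assumes h: "\<And>n. h n + 2 \<le> h (Suc n)"
  obtains E where "\<And>P. P = E \<or> P = - E \<Longrightarrow> \<exists>f::nat \<Rightarrow> nat. strict_mono f \<and> (\<forall>n. \<exists>k\<ge>n. k \<notin> range f) \<and>
      (\<exists>\<^sub>\<infinity>n. {n..g n} \<subseteq> range f) \<and> (\<forall>n\<in>P. f n = h n)"
proof -
  \<comment> \<open>A block starting with the value m = \<open>h (a k)\<close> has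
    \<open>g m + 1\<close> indices, so growth by one at each step covers all of
    \<open>{m..g m}\<close>.\<close>
  define a where "a = rec_nat 0 (\<lambda>_ x. x + g (h x) + 1)"
  have a0: "a 0 = 0" and aS: "a (Suc k) = a k + g (h (a k)) + 1" for k
    by (simp_all add: a_def)
  have a: "strict_mono a" by (simp add: strict_mono_Suc_iff aS)
  have hmono: "strict_mono h"
    unfolding strict_mono_Suc_iff
  proof
    show "h n < h (Suc n)" for n using h[of n] by simp
  qed
  have h2: "h m + 2 * i \<le> h (m + i)" for m i
  proof (induction i)
    case (Suc i)
    then show ?case using h[of "m + i"] by simp
  qed simp
  define b where "b n = (THE k. a k \<le> n \<and> n < a (Suc k))" for n
  have b: "a (b n) \<le> n" "n < a (Suc (b n))" for n
    using theI'[OF block_index[OF a a0, of n]] by (simp_all add: b_def)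
  have bI: "b n = k" if "a k \<le> n" "n < a (Suc k)" for n k
    using block_index[OF a a0, of n] b[of n] that by blast
  have ba: "b (a k) = k" for k by (rule bI) (auto simp: aS)
  define E where "E = {n. even (b n)}"
  have "\<exists>f::nat \<Rightarrow> nat. strict_mono f \<and> (\<forall>n. \<exists>k\<ge>n. k \<notin> range f) \<and>
      (\<exists>\<^sub>\<infinity>n. {n..g n} \<subseteq> range f) \<and> (\<forall>n\<in>P. f n = h n)" if "P = E \<or> P = - E" for P
  proof -
    have "P = {n. even (b n) = (P = E)}"
      using that unfolding E_def by auto
    \<comment> \<open>\<open>q\<close> records the parity of the blocks that make up
      \<open>P\<close>; there \<open>f\<close> copies \<open>h\<close>.\<close>
    then obtain q where P: "P = {n. even (b n) = q}" by metis
    define f where "f n = (if even (b n) = q then h n else h (a (b n)) + (n - a (b n)))" for n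
    have fle: "f n \<le> h n" for n
      using h2[of "a (b n)" "n - a (b n)"] b(1)[of n] by (auto simp: f_def)
    have fa: "f (a k) = h (a k)" for k
      by (simp add: f_def ba)
    have slow: "f (a k + i) = h (a k) + i" if "even k \<noteq> q" "i \<le> g (h (a k))" for k i
      using bI[of k "a k + i"] that by (simp add: f_def aS)
    have mono: "strict_mono f"
      unfolding strict_mono_Suc_iff
    proof
      fix n
      show "f n < f (Suc n)"
      proof (cases "Suc n < a (Suc (b n))")
        case True
        then have "b (Suc n) = b n"
          using b(1)[of n] by (intro bI) auto
        then show ?thesis
          using hmono b(1)[of n] by (auto simp: f_def strict_mono_less)
      next
        case False
        then have "Suc n = a (Suc (b n))"
          using b(2)[of n] by simp
        then have "f (Suc n) = h (Suc n)" using fa by metis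
        then show ?thesis
          using fle[of n] hmono by (metis le_less_trans lessI strict_mono_less)
      qed
    qed
    have ex_slow: "\<exists>k\<ge>n. even k \<noteq> q" for n :: nat
      by (cases "even n = q") (auto intro: exI[of _ n] exI[of _ "Suc n"])
    have "\<exists>v\<ge>n. v \<notin> range f" for n :: nat
    proof -
      obtain k where k: "k \<ge> n" "even k \<noteq> q" using ex_slow[of n] by (elim exE conjE)
      let ?i = "g (h (a k))"
      have 1: "f (a k + ?i) = h (a k) + ?i" using slow k by simp
      have 2: "f (Suc (a k + ?i)) = h (a (Suc k))"
        using fa[of "Suc k"] by (simp add: aS)
      have 3: "h (a k) + 2 * Suc ?i \<le> h (a (Suc k))"
        using h2[of "a k" "Suc ?i"] by (simp add: aS)
      \<comment> \<open>The number just after the last value of a slow block. The next block starts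
        strictly above it, because \<open>h\<close> has gained at least two per index.\<close>
      let ?v = "Suc (f (a k + ?i))"
      have lt: "f (a k + ?i) < ?v" "?v < f (Suc (a k + ?i))" using 1 2 3 by auto
      have "?v \<notin> range f"
      proof
        assume "?v \<in> range f"
        then obtain m where m: "?v = f m" by blast
        have "a k + ?i < m" "m < Suc (a k + ?i)"
          using lt unfolding m strict_mono_less[OF mono] .
        then show False by simp
      qed
      moreover have "n \<le> ?v"
        using strict_mono_imp_increasing[OF mono, of "a k + ?i"]
          strict_mono_imp_increasing[OF a, of k] k(1) by linarith
      ultimately show ?thesis by blast
    qed
    moreover have "\<exists>\<^sub>\<infinity>n. {n..g n} \<subseteq> range f"
      unfolding INFM_nat_le
    proof
      fix n :: nat
      obtain k where k: "k \<ge> n" "even k \<noteq> q" using ex_slow[of n] by (elim exE conjE)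
      let ?m = "h (a k)"
      have "x \<in> range f" if "x \<in> {?m..g ?m}" for x
      proof -
        have "f (a k + (x - ?m)) = x"
          using that k(2) by (subst slow) auto
        then show ?thesis by (metis rangeI)
      qed
      moreover have "n \<le> ?m"
        using strict_mono_imp_increasing[OF hmono, of "a k"]
          strict_mono_imp_increasing[OF a, of k] k(1) by linarith
      ultimately show "\<exists>m\<ge>n. {m..g m} \<subseteq> range f" by blast
    qed
    moreover have "\<forall>n\<in>P. f n = h n" by (auto simp: P f_def)
    ultimately show ?thesis using mono by blast
  qed
  then show ?thesis by (rule that)
qed

text \<open>It is not known in advance which of \<open>E\<close> and \<open>- E\<close> is
  compatible with the centered family, so the runs are available for either choice. On the chosen
  set \<open>P\<close>, \<open>f\<close> agrees with \<open>h\<close> and hence lies above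
  \<open>f0\<close>.\<close>

lemma scale_step:
  assumes reg: "regularCard card_d" and cen: "centered A"
    and A: "|A| <o card_d" and G: "|G| <o card_d"
  obtains f :: "nat \<Rightarrow> nat" where "strict_mono f" "\<forall>n. \<exists>k\<ge>n. k \<notin> range f" "\<exists>\<^sub>\<infinity>n. {n..g n} \<subseteq> range f"
    "centered (A \<union> (\<lambda>u. {n. u n \<le> f n}) ` G)"
proof -
  obtain f0 where f0: "centered (A \<union> (\<lambda>u. {n. u n \<le> f0 n}) ` G)"
    using centered_extend_by_function[OF assms] .
  define h where "h n = (\<Sum>i\<le>n. f0 i + 2)" for n
  have h: "h n + 2 \<le> h (Suc n)" for n by (simp add: h_def)
  have f0h: "f0 n \<le> h n" for n
    using member_le_sum[of n "{..n}" "\<lambda>i. f0 i + 2"] by (simp add: h_def)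
  obtain E where E: "\<And>P. P = E \<or> P = - E \<Longrightarrow> \<exists>f::nat \<Rightarrow> nat. strict_mono f \<and> (\<forall>n. \<exists>k\<ge>n. k \<notin> range f) \<and>
      (\<exists>\<^sub>\<infinity>n. {n..g n} \<subseteq> range f) \<and> (\<forall>n\<in>P. f n = h n)"
    using exists_function_with_runs[of h g] h by blast
  let ?A = "A \<union> (\<lambda>u. {n. u n \<le> f0 n}) ` G"
  obtain P where P: "P = E \<or> P = - E" and cenP: "centered (insert P ?A)"
    using centered_insert_or_Compl[OF f0] by blast
  obtain f where f: "strict_mono f" "\<forall>n. \<exists>k\<ge>n. k \<notin> range f" "\<exists>\<^sub>\<infinity>n. {n..g n} \<subseteq> range f"
      "\<forall>n\<in>P. f n = h n"
    using E[OF P] by blast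
  have "centered (A \<union> (\<lambda>u. {n. u n \<le> f n}) ` G)"
  proof (rule centered_refine[OF cenP])
    fix b assume "b \<in> A \<union> (\<lambda>u. {n. u n \<le> f n}) ` G"
    then show "\<exists>C. finite C \<and> C \<subseteq> insert P ?A \<and> almost_subset (\<Inter>C) b"
    proof
      assume "b \<in> A"
      then show ?thesis
        by (intro exI[of _ "{b}"]) (simp add: almost_subset_def)
    next
      assume "b \<in> (\<lambda>u. {n. u n \<le> f n}) ` G"
      then obtain u where u: "u \<in> G" "b = {n. u n \<le> f n}" by blast
      have "P \<inter> {n. u n \<le> f0 n} \<subseteq> b"
        using f(4) f0h u(2) by (auto intro: order_trans)
      then have "almost_subset (\<Inter>{P, {n. u n \<le> f0 n}}) b"
        by (simp add: almost_subset_def Diff_eq_empty_iff[THEN iffD2])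
      then show ?thesis
        using u(1) by (intro exI[of _ "{P, {n. u n \<le> f0 n}}"]) simp
    qed
  qed
  then show ?thesis using that f by blast
qed

section \<open>The transfinite recursion\<close>

lemma centered_UN_linear:
  assumes r: "total_on I r"
    and mono: "\<And>x y. x \<in> I \<Longrightarrow> y \<in> I \<Longrightarrow> (x, y) \<in> r \<Longrightarrow> A x \<subseteq> A y"
    and cen: "\<And>x. x \<in> I \<Longrightarrow> centered (A x)"
  shows "centered (\<Union>x\<in>I. A x)"
  unfolding centered_def
proof (intro allI impI)
  fix F assume F: "finite F \<and> F \<subseteq> (\<Union>x\<in>I. A x)"
  then have "finite F" "F \<subseteq> (\<Union>x\<in>I. A x)" by auto
  \<comment> \<open>The case of empty \<open>F\<close> also covers an empty index set, as at the
    first stage of the recursion.\<close>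
  then have "F = {} \<or> (\<exists>x\<in>I. F \<subseteq> A x)"
  proof (induction F)
    case (insert b F)
    then obtain y where y: "y \<in> I" "b \<in> A y" by auto
    from insert consider "F = {}" | x where "x \<in> I" "F \<subseteq> A x" by auto
    then show ?case
    proof cases
      case 1
      then show ?thesis using y by auto
    next
      case 2
      have "A x \<subseteq> A y \<or> A y \<subseteq> A x"
        using r mono 2(1) y(1) unfolding total_on_def by (metis order_refl)
      then show ?thesis
        using 2 y by blast
    qed
  qed simp
  then show "infinite (\<Inter>F)"
  proof
    assume "\<exists>x\<in>I. F \<subseteq> A x"
    then show ?thesis using cen F unfolding centered_def by blast
  qed simp
qed

text \<open>\<open>card_d\<close> well-orders a dominating family, so each \<open>x\<close> in its
  field is both an ordinal index and a function to be respected. This is why \<open>x\<close> itself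
  measures the runs of \<open>f x\<close> and why \<open>y\<close> is bounded by \<open>f x\<close>
  from stage \<open>y\<close> on.\<close>

lemma exists_ultrafilter_with_scale:
  assumes reg: "regularCard card_d"
  obtains U and f :: "(nat \<Rightarrow> nat) \<Rightarrow> nat \<Rightarrow> nat"
  where "free_ultrafilter U" "\<And>B. B \<in> U \<or> - B \<in> U"
    "\<And>x. x \<in> Field card_d \<Longrightarrow> strict_mono (f x)"
    "\<And>x n. x \<in> Field card_d \<Longrightarrow> \<exists>k\<ge>n. k \<notin> range (f x)"
    "\<And>x. x \<in> Field card_d \<Longrightarrow> \<exists>\<^sub>\<infinity>n. {n..x n} \<subseteq> range (f x)"
    "\<And>x y. (y, x) \<in> card_d \<Longrightarrow> le_mod U y (f x)"
    "\<And>x y. (y, x) \<in> card_d \<Longrightarrow> y \<noteq> x \<Longrightarrow> le_mod U (f y) (f x)"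
proof -
  let ?r = card_d
  let ?R = "?r - Id"
  have wo: "Well_order ?r" using Card_order_card_d card_order_on_well_order_on by blast
  then have wfR: "wf ?R" and tr: "trans ?r" and anti: "antisym ?r" and tot: "total_on (Field ?r) ?r"
    by (auto simp: well_order_on_def linear_order_on_def partial_order_on_def preorder_on_def)
  have trR: "(x, z) \<in> ?R" if "(x, y) \<in> ?R" "(y, z) \<in> ?r" for x y z
    using that tr anti by (auto dest: transD antisymD)
  \<comment> \<open>The sets contributed by stage \<open>x\<close>: they make \<open>t\<close> a
    bound modulo the ultrafilter for all index functions up to and including \<open>x\<close> and
    for all earlier values of \<open>f\<close>.\<close>
  define news where "news f x t = (\<lambda>u. {n. u n \<le> t n}) ` ({y. (y, x) \<in> ?r} \<union> f ` {y. (y, x) \<in> ?R})"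
    for f :: "(nat \<Rightarrow> nat) \<Rightarrow> nat \<Rightarrow> nat" and x t :: "nat \<Rightarrow> nat"
  define base where "base f x = (\<Union>y\<in>{y. (y, x) \<in> ?R}. news f y (f y))"
    for f :: "(nat \<Rightarrow> nat) \<Rightarrow> nat \<Rightarrow> nat" and x
  define P where "P f x t \<longleftrightarrow> (x \<in> Field ?r \<longrightarrow> strict_mono t \<and> (\<forall>n. \<exists>k\<ge>n. k \<notin> range t) \<and>
      (\<exists>\<^sub>\<infinity>n. {n..x n} \<subseteq> range t) \<and> centered (base f x \<union> news f x t))"
    for f :: "(nat \<Rightarrow> nat) \<Rightarrow> nat \<Rightarrow> nat" and x t :: "nat \<Rightarrow> nat"
  have news_cong: "news f x t = news g x t" if "\<And>z. (z, x) \<in> ?R \<Longrightarrow> f z = g z" for f g x t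
  proof -
    have "f ` {y. (y, x) \<in> ?R} = g ` {y. (y, x) \<in> ?R}"
      by (rule image_cong) (use that in auto)
    then show ?thesis by (simp add: news_def)
  qed
  have base_mono: "base f y \<union> news f y (f y) \<subseteq> base f x" if "(y, x) \<in> ?R" for f x y
    unfolding base_def using that trR by blast
  \<comment> \<open>The union is rewritten with increasing members, the form that
    \<open>centered_UN_linear\<close> can use.\<close>
  have base_eq: "base f x = (\<Union>y\<in>{y. (y, x) \<in> ?R}. base f y \<union> news f y (f y))" for f x
    using base_mono[of _ x f] unfolding base_def[of f x] by blast
  have small: "|{y. (y, x) \<in> ?R}| <o ?r" "|{y. (y, x) \<in> ?r}| <o ?r" if "x \<in> Field ?r" for x
  proof -
    have "{y. (y, x) \<in> ?R} = underS ?r x" by (auto simp: underS_def)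
    then show 1: "|{y. (y, x) \<in> ?R}| <o ?r"
      using card_of_underS[OF Card_order_card_d that] by simp
    have "{y. (y, x) \<in> ?r} \<subseteq> {y. (y, x) \<in> ?R} \<union> {x}" by auto
    then show "|{y. (y, x) \<in> ?r}| <o ?r"
      using 1 by (meson ordLess_card_d_subset ordLess_card_d_Un countable_ordLess_card_d countable_finite
        finite.emptyI finite_insert)
  qed
  have "\<exists>f. \<forall>x. P f x (f x)"
  proof (rule dependent_wf_choice[OF wfR])
    \<comment> \<open>The recursion principle asks that \<open>P f x\<close> depend only on the
      values of \<open>f\<close> strictly below \<open>x\<close>.\<close>
    fix f g :: "(nat \<Rightarrow> nat) \<Rightarrow> nat \<Rightarrow> nat" and x r
    assume eq: "\<And>z. (z, x) \<in> ?R \<Longrightarrow> f z = g z"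
    have "news f y (f y) = news g y (g y)" if "(y, x) \<in> ?R" for y
    proof -
      have "f z = g z" if "(z, y) \<in> ?R" for z
        using eq trR[OF that] \<open>(y, x) \<in> ?R\<close> by blast
      then show ?thesis using news_cong[of y f g] eq[OF that] by simp
    qed
    then have "base f x = base g x" by (simp add: base_def)
    then show "P f x r = P g x r"
      using news_cong[OF eq] by (simp add: P_def)
  next
    fix x f assume IH: "\<And>y. (y, x) \<in> ?R \<Longrightarrow> P f y (f y)"
    show "\<exists>t. P f x t"
    proof (cases "x \<in> Field ?r")
      case True
      have cen: "centered (base f x)"
        unfolding base_eq[of f x]
      proof (rule centered_UN_linear[where r = ?r])
        show "total_on {y. (y, x) \<in> ?R} ?r"
          using tot by (auto simp: total_on_def Field_def)
        show "centered (base f y \<union> news f y (f y))" if "y \<in> {y. (y, x) \<in> ?R}" for y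
          using IH[of y] that by (auto simp: P_def Field_def)
        show "base f y \<union> news f y (f y) \<subseteq> base f z \<union> news f z (f z)" if "(y, z) \<in> ?r" for y z
          using base_mono[of y z f] that by (cases "y = z") auto
      qed
      have "|news f y (f y)| <o ?r" if "(y, x) \<in> ?R" for y
        unfolding news_def using that
        by (intro ordLess_card_d_image ordLess_card_d_Un small) (auto simp: Field_def)
      then have "|base f x| <o ?r"
        unfolding base_def using small[OF True] by (intro ordLess_card_d_UN reg) auto
      moreover have "|{y. (y, x) \<in> ?r} \<union> f ` {y. (y, x) \<in> ?R}| <o ?r"
        by (intro ordLess_card_d_image ordLess_card_d_Un small True)
      ultimately obtain t where "strict_mono t" "\<forall>n. \<exists>k\<ge>n. k \<notin> range t" "\<exists>\<^sub>\<infinity>n. {n..x n} \<subseteq> range t"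
          "centered (base f x \<union> news f x t)"
        unfolding news_def[of f x] by (rule scale_step[OF reg cen])
      then have "P f x t"
        unfolding P_def by (intro impI conjI)
      then show ?thesis by blast
    qed (simp add: P_def)
  qed
  then obtain f where f: "\<And>x. P f x (f x)" by blast
  have "centered (\<Union>x\<in>Field ?r. base f x \<union> news f x (f x))"
  proof (rule centered_UN_linear[OF tot])
    show "base f y \<union> news f y (f y) \<subseteq> base f z \<union> news f z (f z)" if "(y, z) \<in> ?r" for y z
      using base_mono[of y z f] that by (cases "y = z") auto
    show "centered (base f x \<union> news f x (f x))" if "x \<in> Field ?r" for x
      using f[of x, unfolded P_def] that by (elim impE conjE)
  qed
  then obtain U where
    U: "(\<Union>x\<in>Field ?r. base f x \<union> news f x (f x)) \<subseteq> U" "free_ultrafilter U" "\<forall>B. B \<in> U \<or> - B \<in> U"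
    by (rule centered_extends_to_free_ultrafilter)
  have news_U: "news f x (f x) \<subseteq> U" if "x \<in> Field ?r" for x
    using U(1) that by blast
  show ?thesis
  proof (rule that[of U f])
    fix x y assume xy: "(y, x) \<in> ?r"
    then have x: "x \<in> Field ?r" by (auto simp: Field_def)
    show "le_mod U y (f x)"
      using news_U[OF x] xy unfolding news_def le_mod_def by blast
    assume "y \<noteq> x"
    then show "le_mod U (f y) (f x)"
      using news_U[OF x] xy unfolding news_def le_mod_def by blast
  next
    fix x assume "x \<in> Field ?r"
    then show "strict_mono (f x)" "\<exists>\<^sub>\<infinity>n. {n..x n} \<subseteq> range (f x)" "\<exists>k\<ge>n. k \<notin> range (f x)" for n
      using f[of x] by (simp_all add: P_def)
  qed (use U in auto)
qed

section \<open>The bounding number of the ultrafilter\<close>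

lemma dominating_Field_card_d: "dominating (Field card_d)"
  by (metis card_d_dominating Field_card_of)

text \<open>Replace each member of \<open>Y\<close> by an index function dominating it. By
  regularity these fewer than \<open>card_d\<close> indices are not cofinal, so they all lie weakly
  below one \<open>x\<close>, and \<open>f x\<close> bounds \<open>Y\<close>.\<close>

lemma bounded_le_mod_if_small:
  assumes reg: "regularCard card_d" and U: "free_filter U"
    and f: "\<And>x y. (y, x) \<in> card_d \<Longrightarrow> le_mod U y (f x)" and Y: "|Y| <o card_d"
  shows "bounded_wrt (le_mod U) Y"
proof -
  obtain a where a: "\<And>y. a y \<in> Field card_d" "\<And>y. le_star y (a y)"
    using dominating_Field_card_d unfolding dominating_def by metis
  have "\<not> cofinal (a ` Y) card_d"
    using reg a(1) ordLess_card_d_image[OF Y, of a] not_ordLess_ordIso unfolding regularCard_def by blast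
  then obtain x where x: "x \<in> Field card_d" "\<And>y. y \<in> Y \<Longrightarrow> x = a y \<or> (x, a y) \<notin> card_d"
    unfolding cofinal_def by blast
  have wo: "Well_order card_d" using Card_order_card_d card_order_on_well_order_on by blast
  then have tot: "total_on (Field card_d) card_d" and rfl: "refl_on (Field card_d) card_d"
    by (auto simp: well_order_on_def linear_order_on_def partial_order_on_def preorder_on_def)
  have "le_mod U y (f x)" if "y \<in> Y" for y
  proof -
    have "(a y, x) \<in> card_d"
      using x(2)[OF that] x(1) a(1)[of y] tot rfl unfolding total_on_def refl_on_def by metis
    then show ?thesis
      using f le_star_imp_le_mod[OF U a(2)] le_mod_trans[OF U] by blast
  qed
  then show ?thesis
    unfolding bounded_wrt_def by blast
qed

text \<open>One inequality holds because dominating families are unbounded modulo a free filter, the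
  other because smaller families are bounded.\<close>

lemma card_b_eq_card_d:
  assumes U: "free_filter U" and small: "\<And>Y. |Y| <o card_d \<Longrightarrow> bounded_wrt (le_mod U) Y"
  shows "card_b U =o card_d"
proof -
  obtain D where D: "dominating D" "card_d = |D|"
    using card_d_dominating by metis
  have unb: "\<not> bounded_wrt (le_mod U) D"
    using dominating_imp_unbounded_le_mod[OF U D(1)] .
  then have "{Y. \<not> bounded_wrt (le_mod U) Y} \<noteq> {}" by blast
  from min_card_attained[OF this] obtain Y where
    Y: "\<not> bounded_wrt (le_mod U) Y" "card_b U = |Y|" and min: "\<And>Z. \<not> bounded_wrt (le_mod U) Z \<Longrightarrow> |Y| \<le>o |Z|"
    unfolding card_b_def by blast
  have "|Y| \<le>o |D|" using min unb .
  moreover have "|D| \<le>o |Y|"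
    using small[of Y] Y(1) D(2) ordLess_or_ordLeq[OF card_of_Well_order card_of_Well_order, of Y D] by auto
  ultimately show ?thesis
    using Y(2) D(2) ordIso_iff_ordLeq by auto
qed

lemma free_ultrafilter_imp_free_filter: "free_ultrafilter U \<Longrightarrow> free_filter U"
  by (simp add: free_ultrafilter_def)

section \<open>Bounded continuous images of finite powers\<close>

text \<open>
  Boundedness of continuous images need not pass to closed subsets, as a map into the Baire space may
  fail to extend. Building all closed subsets into the property avoids this.
\<close>

definition closed_B :: "nat set set \<Rightarrow> 'a::topological_space set \<Rightarrow> bool" where
  "closed_B U Y \<longleftrightarrow> (\<forall>A \<phi>. closedin (top_of_set Y) A \<and> continuous_on A \<phi> \<longrightarrow>
     bounded_wrt (le_mod U) (\<phi> ` A))"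

definition power_B :: "nat set set \<Rightarrow> 'a::topological_space set \<Rightarrow> bool" where
  "power_B U Y \<longleftrightarrow> (\<forall>k. closed_B U (PiE {..<k::nat} (\<lambda>_. Y)))"

text \<open>Coordinates outside \<open>{..<k}\<close> are constantly \<open>undefined\<close>, so
  they do not affect the topology. This turns finite powers into subspaces of one function
  space.\<close>

lemma finite_power_top_of_set:
  "finite_power (top_of_set Y) k = top_of_set (PiE {..<k} (\<lambda>_. Y))" (is "?P = ?E")
proof -
  have top: "topspace ?P = topspace ?E"
    by (simp add: finite_power_def)
  have "continuous_map ?E ?P id"
    unfolding finite_power_def continuous_map_componentwise
    by (auto simp: continuous_map_in_subtopology PiE_iff extensional_def
        intro!: continuous_on_subset[OF continuous_on_product_coordinates])
  moreover have "continuous_map ?P ?E id"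
    unfolding continuous_map_in_subtopology
  proof
    have "continuous_map ?P euclidean (\<lambda>x. x i)" for i
    proof (cases "i < k")
      case True
      then have "continuous_map ?P (top_of_set Y) (\<lambda>x. x i)"
        unfolding finite_power_def by (intro continuous_map_product_projection) simp
      then show ?thesis by (simp add: continuous_map_in_subtopology)
    next
      case False
      then have "undefined = x i" if "x \<in> topspace ?P" for x
        using that by (auto simp: finite_power_def PiE_iff extensional_def)
      moreover have "continuous_map ?P euclidean (\<lambda>x. undefined)" by simp
      ultimately show ?thesis
        by (rule continuous_map_eq[rotated])
    qed
    then show "continuous_map ?P euclidean id"
      by (simp add: euclidean_product_topology[symmetric] continuous_map_componentwise_UNIV)
    show "id \<in> topspace ?P \<rightarrow> PiE {..<k} (\<lambda>_. Y)"
      by (auto simp: finite_power_def)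
  qed
  ultimately show ?thesis
    unfolding topology_eq using topology_finer_continuous_id[OF top] topology_finer_continuous_id[OF top[symmetric]]
    by blast
qed

lemma power_B_imp_satisfies_B:
  assumes "power_B U Y"
  shows "satisfies_B U (finite_power (top_of_set Y) k)"
  unfolding satisfies_B_def finite_power_top_of_set continuous_map_iff_continuous topspace_euclidean_subtopology
  using assms closedin_self unfolding power_B_def closed_B_def by blast

text \<open>A closed subset of the image pulls back to a closed subset of \<open>Y\<close>, where
  \<open>\<phi>\<close> composed with \<open>p\<close> has the same values.\<close>

lemma closed_B_continuous_image:
  assumes Y: "closed_B U Y" and p: "continuous_on Y p"
  shows "closed_B U (p ` Y)"
  unfolding closed_B_def
proof (intro allI impI, elim conjE)
  fix A \<phi> assume A: "closedin (top_of_set (p ` Y)) A" and \<phi>: "continuous_on A (\<phi> :: _ \<Rightarrow> nat \<Rightarrow> nat)"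
  let ?B = "Y \<inter> p -` A"
  have img: "p ` ?B = A"
    using closedin_imp_subset[OF A] by auto
  have "closedin (top_of_set Y) ?B"
    using continuous_closedin_preimage_gen[OF p _ A] by simp
  moreover have "continuous_on ?B (\<phi> \<circ> p)"
    using continuous_on_subset[OF p] \<phi> img by (intro continuous_on_compose) auto
  ultimately have "bounded_wrt (le_mod U) ((\<phi> \<circ> p) ` ?B)"
    using Y unfolding closed_B_def by blast
  then show "bounded_wrt (le_mod U) (\<phi> ` A)"
    by (metis image_comp img)
qed

lemma closed_B_closedin:
  "closed_B U Y \<Longrightarrow> closedin (top_of_set Y) Z \<Longrightarrow> closed_B U Z"
  unfolding closed_B_def by (blast intro: closedin_trans)

text \<open>The countably many bounds found on the pieces have a common bound.\<close>

lemma closed_B_UN: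
  fixes Y :: "nat \<Rightarrow> 'a::topological_space set"
  assumes U: "free_filter U" and cnt: "\<And>Z. countable Z \<Longrightarrow> bounded_wrt (le_mod U) Z"
    and Y: "\<And>n. closed_B U (Y n)"
  shows "closed_B U (\<Union>n. Y n)"
  unfolding closed_B_def
proof (intro allI impI, elim conjE)
  fix A \<phi> assume A: "closedin (top_of_set (\<Union>n. Y n)) A" and \<phi>: "continuous_on A (\<phi> :: _ \<Rightarrow> nat \<Rightarrow> nat)"
  have "\<exists>g. \<forall>x\<in>A \<inter> Y n. le_mod U (\<phi> x) g" for n
  proof -
    have "closedin (top_of_set (Y n)) (A \<inter> Y n)"
      using A by (auto simp: closedin_subtopology)
    moreover have "continuous_on (A \<inter> Y n) \<phi>"
      using \<phi> continuous_on_subset by blast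
    ultimately have "bounded_wrt (le_mod U) (\<phi> ` (A \<inter> Y n))"
      using Y unfolding closed_B_def by blast
    then show ?thesis by (auto simp: bounded_wrt_def)
  qed
  then obtain g where g: "\<And>n x. x \<in> A \<inter> Y n \<Longrightarrow> le_mod U (\<phi> x) (g n)" by metis
  obtain g' where g': "\<And>n. le_mod U (g n) g'"
    using cnt[of "range g"] by (auto simp: bounded_wrt_def)
  have "le_mod U (\<phi> x) g'" if "x \<in> A" for x
    using closedin_imp_subset[OF A] that g g' le_mod_trans[OF U] by blast
  then show "bounded_wrt (le_mod U) (\<phi> ` A)"
    by (auto simp: bounded_wrt_def)
qed

text \<open>Monotonicity puts the finitely many coordinates of a point into a single
  \<open>Y n\<close>, so the power of the union is the union of the powers.\<close>

lemma power_B_UN: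
  fixes Y :: "nat \<Rightarrow> 'a::topological_space set"
  assumes U: "free_filter U" and cnt: "\<And>Z. countable Z \<Longrightarrow> bounded_wrt (le_mod U) Z"
    and Y: "\<And>n. power_B U (Y n)" and mono: "\<And>n. Y n \<subseteq> Y (Suc n)"
  shows "power_B U (\<Union>n. Y n)"
  unfolding power_B_def
proof
  fix k :: nat
  have incr: "Y m \<subseteq> Y n" if "m \<le> n" for m n
    using lift_Suc_mono_le[of Y, OF mono that] .
  have "PiE {..<k} (\<lambda>_. \<Union>n. Y n) = (\<Union>n. PiE {..<k} (\<lambda>_. Y n))"
  proof
    show "PiE {..<k} (\<lambda>_. \<Union>n. Y n) \<subseteq> (\<Union>n. PiE {..<k} (\<lambda>_. Y n))"
    proof
      fix x assume x: "x \<in> PiE {..<k} (\<lambda>_. \<Union>n. Y n)"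
      then have "\<forall>i\<in>{..<k}. \<exists>n. x i \<in> Y n" by auto
      then obtain m where m: "\<And>i. i < k \<Longrightarrow> x i \<in> Y (m i)"
        using bchoice[of "{..<k}" "\<lambda>i n. x i \<in> Y n"] by auto
      have "x i \<in> Y (\<Sum>i<k. m i)" if "i < k" for i
        using m[OF that] incr[of "m i" "\<Sum>i<k. m i"] that
        by (meson finite_lessThan lessThan_iff member_le_sum subsetD zero_le)
      then show "x \<in> (\<Union>n. PiE {..<k} (\<lambda>_. Y n))"
        using x by (auto simp: PiE_iff)
    qed
  qed (auto simp: PiE_iff)
  moreover have "closed_B U (\<Union>n. PiE {..<k} (\<lambda>_. Y n))"
    using Y by (intro closed_B_UN[OF U cnt]) (auto simp: power_B_def)
  ultimately show "closed_B U (PiE {..<k} (\<lambda>_. \<Union>n. Y n))" by simp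
qed

lemma continuous_on_restrict:
  fixes p :: "'a::topological_space \<Rightarrow> 'i \<Rightarrow> 'b::topological_space"
  assumes "\<And>i. i \<in> I \<Longrightarrow> continuous_on S (\<lambda>x. p x i)"
  shows "continuous_on S (\<lambda>x. restrict (p x) I)"
proof (rule continuous_on_coordinatewise_then_product)
  show "continuous_on S (\<lambda>x. restrict (p x) I i)" for i
    using assms by (cases "i \<in> I") auto
qed

lemma continuous_on_coordinate: "continuous_on S (\<lambda>x. x i)"
  by (rule continuous_on_subset[OF continuous_on_product_coordinates]) simp

text \<open>The \<open>k\<close>-th power of the set of quotients is a continuous image of a closed
  part of the \<open>3 * k\<close>-th power of \<open>Y\<close>. Keeping denominators at distance
  \<epsilon> from zero makes that part closed.\<close>

lemma power_B_quotients:
  fixes Y :: "real set"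
  assumes Y: "power_B U Y" and "\<epsilon> > 0"
  shows "power_B U {a - b / c |a b c. a \<in> Y \<and> b \<in> Y \<and> c \<in> Y \<and> \<epsilon> \<le> \<bar>c\<bar>}" (is "power_B U ?Q")
  unfolding power_B_def
proof
  fix k :: nat
  let ?Y = "PiE {..<3 * k} (\<lambda>_. Y)"
  define A where "A = {x \<in> ?Y. \<forall>i<k. \<epsilon> \<le> \<bar>x (3 * i + 2)\<bar>}"
  define p where "p x = (\<lambda>i\<in>{..<k}. x (3 * i) - x (3 * i + 1) / x (3 * i + 2))" for x :: "nat \<Rightarrow> real"
  have "closed {x :: nat \<Rightarrow> real. \<forall>i<k. \<epsilon> \<le> \<bar>x (3 * i + 2)\<bar>}"
    unfolding Collect_all_eq
    by (intro closed_INT ballI closed_Collect_imp open_Collect_const closed_Collect_le continuous_intros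
        continuous_on_coordinate)
  then have "closedin (top_of_set ?Y) A"
    unfolding A_def by (auto simp: closedin_closed)
  then have "closed_B U A"
    using Y closed_B_closedin unfolding power_B_def by blast
  moreover have "continuous_on A p"
    unfolding p_def using \<open>\<epsilon> > 0\<close>
    by (intro continuous_on_restrict continuous_intros continuous_on_coordinate) (force simp: A_def)
  ultimately have "closed_B U (p ` A)"
    by (rule closed_B_continuous_image)
  moreover have "p ` A = PiE {..<k} (\<lambda>_. ?Q)"
  proof
    show "p ` A \<subseteq> PiE {..<k} (\<lambda>_. ?Q)"
    proof
      fix y assume "y \<in> p ` A"
      then obtain x where x: "x \<in> A" "y = p x" by blast
      have "x (3 * i) - x (3 * i + 1) / x (3 * i + 2) \<in> ?Q" if "i < k" for i
        using that x(1) unfolding A_def PiE_iff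
        by (intro CollectI exI[of _ "x (3 * i)"] exI[of _ "x (3 * i + 1)"] exI[of _ "x (3 * i + 2)"]) auto
      then show "y \<in> PiE {..<k} (\<lambda>_. ?Q)"
        by (simp add: x(2) p_def)
    qed
    show "PiE {..<k} (\<lambda>_. ?Q) \<subseteq> p ` A"
    proof
      fix y assume y: "y \<in> PiE {..<k} (\<lambda>_. ?Q)"
      then have "\<forall>i\<in>{..<k}. \<exists>a b c. y i = a - b / c \<and> a \<in> Y \<and> b \<in> Y \<and> c \<in> Y \<and> \<epsilon> \<le> \<bar>c\<bar>"
        by (auto simp: PiE_iff)
      then obtain a b c where abc: "\<And>i. i < k \<Longrightarrow> y i = a i - b i / c i \<and> a i \<in> Y \<and> b i \<in> Y \<and> c i \<in> Y \<and> \<epsilon> \<le> \<bar>c i\<bar>"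
        by (simp add: Ball_def) metis
      define x where "x = (\<lambda>m\<in>{..<3 * k}. if m mod 3 = 0 then a (m div 3) else
        if m mod 3 = 1 then b (m div 3) else c (m div 3))"
      have xi: "x (3 * i) = a i" "x (3 * i + 1) = b i" "x (3 * i + 2) = c i" if "i < k" for i
      proof -
        have "(3 * i + 1) div 3 = i" "(3 * i + 2) div 3 = i" "(3 * i + 1) mod 3 = 1" "(3 * i + 2) mod 3 = 2"
          by presburger+
        then show "x (3 * i) = a i" "x (3 * i + 1) = b i" "x (3 * i + 2) = c i"
          using that by (simp_all add: x_def del: add_2_eq_Suc')
      qed
      have "x \<in> A"
        unfolding A_def
      proof (intro CollectI conjI allI impI)
        show "x \<in> ?Y"
          unfolding x_def by (intro restrict_PiE_iff[THEN iffD2] ballI) (auto simp: abc less_mult_imp_div_less mult.commute)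
        show "\<epsilon> \<le> \<bar>x (3 * i + 2)\<bar>" if "i < k" for i
          unfolding xi[OF that] using abc[OF that] by blast
      qed
      moreover have "y = p x"
      proof
        fix i
        show "y i = p x i"
        proof (cases "i < k")
          case True
          then show ?thesis by (simp add: p_def xi[simplified] abc)
        next
          case False
          then show ?thesis using y by (simp add: p_def PiE_iff extensional_def)
        qed
      qed
      ultimately show "y \<in> p ` A" by blast
    qed
  qed
  ultimately show "closed_B U (PiE {..<k} (\<lambda>_. ?Q))" by simp
qed

section \<open>Finite powers of a scale together with a small set\<close>

lemma compact_PiE_lessThan:
  fixes C :: "'a::topological_space set"
  assumes "compact C"
  shows "compact (PiE {..<k::nat} (\<lambda>_. C))"
proof -
  \<comment> \<open>Singleton factors at the remaining coordinates turn the set into a full product,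
    to which Tychonoff's theorem applies.\<close>
  have eq: "PiE {..<k} (\<lambda>_. C) = PiE UNIV (\<lambda>i. if i < k then C else {undefined})"
  proof (intro subset_antisym subsetI)
    fix x assume x: "x \<in> PiE UNIV (\<lambda>i. if i < k then C else {undefined})"
    have "x i \<in> (if i < k then C else {undefined})" for i
      by (rule PiE_mem[OF x]) simp
    then show "x \<in> PiE {..<k} (\<lambda>_. C)"
      by (intro PiE_I) (metis lessThan_iff, metis lessThan_iff singletonD)
  qed (simp add: PiE_iff extensional_def)
  have "compactin (product_topology (\<lambda>_. euclidean) UNIV) (PiE UNIV (\<lambda>i. if i < k then C else {undefined}))"
    unfolding compactin_PiE using assms by auto
  then show ?thesis
    unfolding eq by (simp add: euclidean_product_topology)
qed

text \<open>
  A sequence violating the bound for every \<open>m\<close> accumulates at a point all of whose coordinates take the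
  value \<open>\<infinity>\<close> at \<open>n\<close>; such a point belongs to \<open>A\<close>, where \<open>\<phi>\<close> is locally constant in each coordinate.
\<close>

lemma escape_bound:
  fixes C :: "'a::metric_space set" and e :: "'a \<Rightarrow> nat \<Rightarrow> enat" and \<phi> :: "(nat \<Rightarrow> 'a) \<Rightarrow> nat \<Rightarrow> nat"
  assumes C: "compact C" and e: "continuous_on C e" and W: "{c \<in> C. \<exists>n. e c n = \<infinity>} \<subseteq> W"
    and A: "closedin (top_of_set (PiE {..<k} (\<lambda>_. W))) A" and \<phi>: "continuous_on A \<phi>"
  shows "\<exists>m. \<forall>x\<in>A. (\<forall>i<k. x i \<in> C \<and> enat m < e (x i) n) \<longrightarrow> \<phi> x n \<le> m"
proof (rule ccontr)
  assume "\<not> ?thesis"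
  then have "\<exists>x. \<forall>m. x m \<in> A \<and> (\<forall>i<k. x m i \<in> C \<and> enat m < e (x m i) n) \<and> m < \<phi> (x m) n"
    by (intro choice) (auto simp: not_le)
  then obtain x where x: "\<And>m. x m \<in> A" "\<And>m i. i < k \<Longrightarrow> x m i \<in> C"
      "\<And>m i. i < k \<Longrightarrow> enat m < e (x m i) n" "\<And>m. m < \<phi> (x m) n"
    by auto
  have AW: "A \<subseteq> PiE {..<k} (\<lambda>_. W)" using closedin_imp_subset[OF A] .
  obtain T where T: "closed T" "A = PiE {..<k} (\<lambda>_. W) \<inter> T"
    using A by (auto simp: closedin_closed)
  \<comment> \<open>The points of \<open>W\<close> need not lie in \<open>C\<close>; compactness is
    available because the violating points have all their coordinates in \<open>C\<close>.\<close>
  have "x m \<in> PiE {..<k} (\<lambda>_. C)" for m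
    using x(1)[of m] x(2) AW by (auto simp: PiE_iff)
  then obtain l r where l: "l \<in> PiE {..<k} (\<lambda>_. C)" and r: "strict_mono r" and lim: "(x \<circ> r) \<longlonglongrightarrow> l"
    using seq_compactE[OF compact_imp_seq_compact[OF compact_PiE_lessThan[OF C]]] by metis
  have limi: "(\<lambda>j. x (r j) i) \<longlonglongrightarrow> l i" for i
    using continuous_on_tendsto_compose[OF continuous_on_coordinate[of UNIV i] lim] by (simp add: o_def)
  have "e (l i) n = \<infinity>" if "i < k" for i
  proof -
    have en: "continuous_on C (\<lambda>c. e c n)"
      using e by (rule continuous_on_product_then_coordinatewise)
    have "(\<lambda>j. e (x (r j) i) n) \<longlonglongrightarrow> e (l i) n"
      using l x(2)[OF that] that by (intro continuous_on_tendsto_compose[OF en limi]) (auto simp: PiE_iff)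
    moreover have "enat M \<le> e (x (r j) i) n" if "j \<ge> M" for j M
    proof -
      have "M \<le> r j" using seq_suble[OF r, of j] that by simp
      then show ?thesis
        using x(3)[OF \<open>i < k\<close>, of "r j"] by (meson enat_ord_simps(1) le_less_trans less_imp_le)
    qed
    ultimately have "enat M \<le> e (l i) n" for M
      by (meson LIMSEQ_le_const)
    then show ?thesis
      by (metis enat_ord_code(3) enat_ord_simps(1) not_less_eq_eq order_refl enat.exhaust)
  qed
  then have "l \<in> PiE {..<k} (\<lambda>_. W)"
    using l W by (auto simp: PiE_iff)
  moreover have "l \<in> T"
    using closed_sequentially[OF T(1) _ lim] x(1) T(2) by auto
  ultimately have "l \<in> A" using T(2) by blast
  then have "(\<lambda>j. \<phi> (x (r j)) n) \<longlonglongrightarrow> \<phi> l n"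
    using continuous_on_tendsto_compose[OF continuous_on_product_then_coordinatewise[OF \<phi>] lim] x(1)
    by (auto simp: o_def)
  \<comment> \<open>Convergence in a discrete space means being eventually constant, whereas these
    values exceed \<open>r j\<close> and so tend to infinity.\<close>
  then have "\<forall>\<^sub>F j in sequentially. \<phi> (x (r j)) n = \<phi> l n"
    by (simp add: tendsto_discrete)
  then obtain N where N: "\<And>j. j \<ge> N \<Longrightarrow> \<phi> (x (r j)) n = \<phi> l n"
    by (auto simp: eventually_sequentially)
  let ?j = "max N (\<phi> l n)"
  have "r ?j < \<phi> l n" using x(4)[of "r ?j"] N[of ?j] by simp
  then show False using seq_suble[OF r, of ?j] by simp
qed

text \<open>The slice is the image of the \<open>k\<close>-th power under inserting \<open>p\<close>
  at position \<open>i\<close>.\<close>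

lemma closed_B_slice:
  fixes W :: "'a::topological_space set"
  assumes W: "closed_B U (PiE {..<k} (\<lambda>_. W))" and "i \<le> k" and "p \<in> W"
  shows "closed_B U {x \<in> PiE {..<Suc k} (\<lambda>_. W). x i = p}"
proof -
  define ins where "ins y = (\<lambda>m\<in>{..<Suc k}. if m < i then y m else if m = i then p else y (m - 1))"
    for y :: "nat \<Rightarrow> 'a"
  have "continuous_on (PiE {..<k} (\<lambda>_. W)) ins"
    unfolding ins_def
  proof (rule continuous_on_restrict)
    show "continuous_on (PiE {..<k} (\<lambda>_. W)) (\<lambda>y. if m < i then y m else if m = i then p else y (m - 1))" for m
      by (cases "m < i"; cases "m = i") (simp_all add: continuous_on_coordinate)
  qed
  then have "closed_B U (ins ` PiE {..<k} (\<lambda>_. W))"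
    using W closed_B_continuous_image by blast
  moreover have "ins ` PiE {..<k} (\<lambda>_. W) = {x \<in> PiE {..<Suc k} (\<lambda>_. W). x i = p}"
  proof
    have "(if m < i then y m else if m = i then p else y (m - 1)) \<in> W"
      if "y \<in> PiE {..<k} (\<lambda>_. W)" "m < Suc k" for y m
    proof -
      have "m < i \<Longrightarrow> m < k" "\<not> m < i \<Longrightarrow> m \<noteq> i \<Longrightarrow> m - 1 < k"
        using that(2) \<open>i \<le> k\<close> by auto
      then show ?thesis using that(1) \<open>p \<in> W\<close> by (auto simp: PiE_iff)
    qed
    then show "ins ` PiE {..<k} (\<lambda>_. W) \<subseteq> {x \<in> PiE {..<Suc k} (\<lambda>_. W). x i = p}"
      using \<open>i \<le> k\<close> by (auto simp: ins_def)
    show "{x \<in> PiE {..<Suc k} (\<lambda>_. W). x i = p} \<subseteq> ins ` PiE {..<k} (\<lambda>_. W)"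
    proof
      fix x assume x: "x \<in> {x \<in> PiE {..<Suc k} (\<lambda>_. W). x i = p}"
      define y where "y = (\<lambda>m\<in>{..<k}. if m < i then x m else x (Suc m))"
      have "y \<in> PiE {..<k} (\<lambda>_. W)"
        using x by (auto simp: y_def PiE_iff)
      moreover have "x = ins y"
      proof
        fix m
        show "x m = ins y m"
          using x \<open>i \<le> k\<close> by (cases "m < Suc k") (auto simp: ins_def y_def PiE_iff extensional_def)
      qed
      ultimately show "x \<in> ins ` PiE {..<k} (\<lambda>_. W)" by blast
    qed
  qed
  ultimately show ?thesis by simp
qed

text \<open>Induction on the exponent: slices are handled by the previous power, the other points by
  \<open>escape_bound\<close>. \<open>Z\<close> may reach outside \<open>C\<close>, which allows 0
  and 1 to be added later.\<close>

lemma power_B_scale: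
  fixes C Z :: "'a::metric_space set" and e :: "'a \<Rightarrow> nat \<Rightarrow> enat" and s :: "(nat \<Rightarrow> nat) \<Rightarrow> 'a"
  assumes U: "free_filter U" and ultra: "\<And>B. B \<in> U \<or> - B \<in> U"
    and small: "\<And>Y. |Y| <o card_d \<Longrightarrow> bounded_wrt (le_mod U) Y"
    and unb: "\<not> bounded_wrt (le_mod U) (f ` Field card_d)"
    and scale: "\<And>x y. (y, x) \<in> card_d \<Longrightarrow> y \<noteq> x \<Longrightarrow> le_mod U (f y) (f x)"
    and C: "compact C" and e: "continuous_on C e"
    and Z: "{c \<in> C. \<exists>n. e c n = \<infinity>} \<subseteq> Z" "|Z| <o card_d"
    and s: "\<And>x. x \<in> Field card_d \<Longrightarrow> s x \<in> C \<and> e (s x) = enat_seq (f x)"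
  shows "power_B U (Z \<union> s ` Field card_d)"
proof -
  let ?W = "Z \<union> s ` Field card_d"
  have W: "{c \<in> C. \<exists>n. e c n = \<infinity>} \<subseteq> ?W" using Z by blast
  have wo: "Well_order card_d" using Card_order_card_d card_order_on_well_order_on by blast
  then have tot: "total_on (Field card_d) card_d" and rfl: "refl_on (Field card_d) card_d"
    by (auto simp: well_order_on_def linear_order_on_def partial_order_on_def preorder_on_def)
  have "closed_B U (PiE {..<k} (\<lambda>_. ?W))" for k :: nat
  proof (induction k)
    case 0
    have "|\<phi> ` A| <o card_d" if "A \<subseteq> {\<lambda>_. undefined}" for A :: "(nat \<Rightarrow> 'a) set" and \<phi> :: "_ \<Rightarrow> nat \<Rightarrow> nat"
      using that by (intro countable_ordLess_card_d countable_finite finite_imageI) (rule finite_subset, auto)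
    then show ?case
      unfolding closed_B_def using small closedin_imp_subset
      by (metis PiE_empty_domain lessThan_0)
  next
    case (Suc k)
    show ?case
      unfolding closed_B_def
    proof (intro allI impI, elim conjE)
      fix A \<phi> assume A: "closedin (top_of_set (PiE {..<Suc k} (\<lambda>_. ?W))) A"
        and \<phi>: "continuous_on A (\<phi> :: _ \<Rightarrow> nat \<Rightarrow> nat)"
      have AW: "A \<subseteq> PiE {..<Suc k} (\<lambda>_. ?W)" using closedin_imp_subset[OF A] .
      obtain g where g: "\<And>n x. x \<in> A \<Longrightarrow> (\<forall>i<Suc k. x i \<in> C \<and> enat (g n) < e (x i) n) \<Longrightarrow> \<phi> x n \<le> g n"
        using escape_bound[OF C e W A \<phi>] by metis
      obtain x0 where x0: "x0 \<in> Field card_d" "\<not> le_mod U (f x0) g"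
        using unb by (auto simp: bounded_wrt_def)
      \<comment> \<open>For an ultrafilter, failing to be \<le> \<open>g\<close> means exceeding
        \<open>g\<close> on a set in \<open>U\<close>; this passes from \<open>x0\<close> up the
        scale.\<close>
      have above: "{n. g n < f x n} \<in> U" if "(x0, x) \<in> card_d" for x
      proof -
        have "\<not> le_mod U (f x) g"
          using scale[OF that] x0(2) le_mod_trans[OF U] by (cases "x0 = x") auto
        then have "- {n. f x n \<le> g n} \<in> U"
          using ultra unfolding le_mod_def by blast
        then show ?thesis by (rule back_subst[of "\<lambda>A. A \<in> U"]) auto
      qed
      \<comment> \<open>The values of a coordinate for which exceeding \<open>g\<close> on a set in
        \<open>U\<close> is not guaranteed. There are fewer than \<open>card_d\<close> of them,
        hence fewer than \<open>card_d\<close> slices.\<close>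
      define W0 where "W0 = Z \<union> s ` {x. (x, x0) \<in> card_d \<and> x \<noteq> x0}"
      have "{x. (x, x0) \<in> card_d \<and> x \<noteq> x0} = underS card_d x0" by (auto simp: underS_def)
      then have W0: "|W0| <o card_d"
        unfolding W0_def using card_of_underS[OF Card_order_card_d x0(1)] Z(2)
        by (simp add: ordLess_card_d_Un ordLess_card_d_image)
      have "bounded_wrt (le_mod U) (\<phi> ` {x \<in> A. x i = p})" if "i < Suc k" for i p
      proof (cases "p \<in> ?W")
        case True
        have "closed_B U {x \<in> PiE {..<Suc k} (\<lambda>_. ?W). x i = p}"
          using that by (intro closed_B_slice Suc.IH True) simp
        moreover have "closedin (top_of_set {x \<in> PiE {..<Suc k} (\<lambda>_. ?W). x i = p}) {x \<in> A. x i = p}"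
          using A AW by (auto simp: closedin_closed)
        moreover have "continuous_on {x \<in> A. x i = p} \<phi>"
          using \<phi> by (rule continuous_on_subset) auto
        ultimately show ?thesis unfolding closed_B_def by blast
      next
        \<comment> \<open>Empty slices are included so that \<open>G\<close> can be chosen for every
          \<open>p\<close>.\<close>
        case False
        then have "{x \<in> A. x i = p} = {}" using AW that by (auto simp: PiE_iff)
        then show ?thesis by (simp only: image_empty bounded_wrt_def) simp
      qed
      then have "\<exists>G. \<forall>x\<in>A. x i = p \<longrightarrow> le_mod U (\<phi> x) G" if "i < Suc k" for i p
        using that unfolding bounded_wrt_def by blast
      then obtain G where G: "\<And>i p x. i < Suc k \<Longrightarrow> x \<in> A \<Longrightarrow> x i = p \<Longrightarrow> le_mod U (\<phi> x) (G i p)"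
        by metis
      have "|{g} \<union> (\<lambda>(i, p). G i p) ` ({..<Suc k} \<times> W0)| <o card_d"
        by (intro ordLess_card_d_Un ordLess_card_d_image ordLess_card_d_Times W0
            countable_ordLess_card_d countable_finite) auto
      then obtain g' where g': "le_mod U g g'" "\<And>i p. i < Suc k \<Longrightarrow> p \<in> W0 \<Longrightarrow> le_mod U (G i p) g'"
        by (rule small[unfolded bounded_wrt_def, elim_format]) auto
      have "le_mod U (\<phi> x) g'" if x: "x \<in> A" for x
      proof (cases "\<exists>i<Suc k. x i \<in> W0")
        case True
        then show ?thesis
          using G[OF _ x refl] g'(2) le_mod_trans[OF U] by blast
      next
        case False
        have "{n. x i \<in> C \<and> enat (g n) < e (x i) n} \<in> U" if "i \<in> {..<Suc k}" for i
        proof -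
          have "x i \<in> ?W" "x i \<notin> W0"
            using x AW that False by (auto simp: PiE_iff)
          then obtain y where y: "y \<in> Field card_d" "x i = s y" "y = x0 \<or> (y, x0) \<notin> card_d"
            unfolding W0_def by blast
          then have "(x0, y) \<in> card_d"
            using tot rfl x0(1) unfolding total_on_def refl_on_def by metis
          from above[OF this] show ?thesis
            using s[OF y(1)] y(2) by (simp add: enat_seq_def)
        qed
        then have "{n. \<forall>i\<in>{..<Suc k}. x i \<in> C \<and> enat (g n) < e (x i) n} \<in> U"
          by (intro free_filter_Ball_finite U) auto
        then have "le_mod U (\<phi> x) g"
          unfolding le_mod_def by (rule free_filter_superset[OF U]) (use g[OF x] in auto)
        then show ?thesis using g'(1) le_mod_trans[OF U] by blast
      qed
      then show "bounded_wrt (le_mod U) (\<phi> ` A)"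
        unfolding bounded_wrt_def by blast
    qed
  qed
  then show ?thesis by (simp add: power_B_def)
qed

section \<open>Generated subfields\<close>

definition eval_monom :: "(real \<Rightarrow>\<^sub>0 nat) \<Rightarrow> real" where
  "eval_monom m = (\<Prod>x\<in>Poly_Mapping.keys m. x ^ poly_mapping.lookup m x)"

text \<open>Zero exponents contribute factors 1, so monomials with different supports can be
  evaluated over a common index set.\<close>

lemma eval_monom_superset:
  assumes "finite B" "Poly_Mapping.keys m \<subseteq> B"
  shows "eval_monom m = (\<Prod>x\<in>B. x ^ poly_mapping.lookup m x)"
  unfolding eval_monom_def using assms
  by (intro prod.mono_neutral_left) (auto simp: in_keys_iff)

lemma eval_monom_add: "eval_monom (m + m') = eval_monom m * eval_monom m'"
proof -
  let ?B = "Poly_Mapping.keys m \<union> Poly_Mapping.keys m'"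
  have "eval_monom (m + m') = (\<Prod>x\<in>?B. x ^ poly_mapping.lookup (m + m') x)"
    by (rule eval_monom_superset) (simp_all add: Poly_Mapping.keys_add)
  also have "\<dots> = (\<Prod>x\<in>?B. x ^ poly_mapping.lookup m x) * (\<Prod>x\<in>?B. x ^ poly_mapping.lookup m' x)"
    by (simp add: lookup_add power_add prod.distrib)
  also have "\<dots> = eval_monom m * eval_monom m'"
    by (simp add: eval_monom_superset[symmetric])
  finally show ?thesis .
qed

lemma eval_rat_poly_superset:
  assumes "finite M" "Poly_Mapping.keys p \<subseteq> M"
  shows "eval_rat_poly p = (\<Sum>m\<in>M. of_rat (poly_mapping.lookup p m) * eval_monom m)"
  unfolding eval_rat_poly_def eval_monom_def[symmetric] using assms
  by (intro sum.mono_neutral_left) (auto simp: in_keys_iff)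

lemma eval_rat_poly_add: "eval_rat_poly (p + q) = eval_rat_poly p + eval_rat_poly q"
proof -
  let ?M = "Poly_Mapping.keys p \<union> Poly_Mapping.keys q"
  have "eval_rat_poly (p + q) = (\<Sum>m\<in>?M. of_rat (poly_mapping.lookup (p + q) m) * eval_monom m)"
    by (rule eval_rat_poly_superset) (simp_all add: Poly_Mapping.keys_add)
  also have "\<dots> = eval_rat_poly p + eval_rat_poly q"
    by (simp add: lookup_add of_rat_add distrib_right sum.distrib eval_rat_poly_superset[symmetric])
  finally show ?thesis .
qed

lemma eval_rat_poly_single [simp]: "eval_rat_poly (Poly_Mapping.single m a) = of_rat a * eval_monom m"
  by (subst eval_rat_poly_superset[of "{m}"]) auto

lemma eval_rat_poly_0 [simp]: "eval_rat_poly 0 = 0"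
  by (simp add: eval_rat_poly_def)

lemma eval_rat_poly_uminus: "eval_rat_poly (- p) = - eval_rat_poly p"
  using eval_rat_poly_add[of p "- p"] by simp

lemma eval_rat_poly_sum: "eval_rat_poly (\<Sum>i\<in>I. p i) = (\<Sum>i\<in>I. eval_rat_poly (p i))"
  by (induction I rule: infinite_finite_induct) (auto simp: eval_rat_poly_add)

lemma poly_mapping_sum_single: "p = (\<Sum>m\<in>Poly_Mapping.keys p. Poly_Mapping.single m (poly_mapping.lookup p m))"
  by (rule poly_mapping_eqI) (simp add: lookup_sum lookup_single when_def in_keys_iff)

lemma eval_rat_poly_mult: "eval_rat_poly (p * q) = eval_rat_poly p * eval_rat_poly q"
proof -
  have "p * q = (\<Sum>m\<in>Poly_Mapping.keys p. \<Sum>m'\<in>Poly_Mapping.keys q.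
      Poly_Mapping.single (m + m') (poly_mapping.lookup p m * poly_mapping.lookup q m'))"
    by (subst (1) poly_mapping_sum_single[of p], subst (1) poly_mapping_sum_single[of q])
      (simp only: sum_product mult_single)
  then have "eval_rat_poly (p * q) = (\<Sum>m\<in>Poly_Mapping.keys p. \<Sum>m'\<in>Poly_Mapping.keys q.
      (of_rat (poly_mapping.lookup p m) * eval_monom m) * (of_rat (poly_mapping.lookup q m') * eval_monom m'))"
    by (simp add: eval_rat_poly_sum of_rat_mult eval_monom_add mult_ac)
  then show ?thesis
    by (simp only: eval_rat_poly_def eval_monom_def[symmetric] sum_product)
qed

definition vars_in :: "real set \<Rightarrow> ((real \<Rightarrow>\<^sub>0 nat) \<Rightarrow>\<^sub>0 rat) \<Rightarrow> bool" where
  "vars_in X p \<longleftrightarrow> (\<forall>m\<in>Poly_Mapping.keys p. Poly_Mapping.keys m \<subseteq> X)"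

lemma vars_in_add: "vars_in X p \<Longrightarrow> vars_in X q \<Longrightarrow> vars_in X (p + q)"
  unfolding vars_in_def using Poly_Mapping.keys_add[of p q] by blast

lemma vars_in_uminus: "vars_in X p \<Longrightarrow> vars_in X (- p)"
  by (simp add: vars_in_def in_keys_iff)

lemma vars_in_mult:
  assumes "vars_in X p" "vars_in X q"
  shows "vars_in X (p * q)"
  unfolding vars_in_def
proof
  fix m assume "m \<in> Poly_Mapping.keys (p * q)"
  then obtain a b where "a \<in> Poly_Mapping.keys p" "b \<in> Poly_Mapping.keys q" "m = a + b"
    using keys_mult[of p q] by blast
  then show "Poly_Mapping.keys m \<subseteq> X"
    using assms Poly_Mapping.keys_add[of a b] unfolding vars_in_def by blast
qed

lemma vars_in_mono: "vars_in X p \<Longrightarrow> X \<subseteq> Y \<Longrightarrow> vars_in Y p"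
  unfolding vars_in_def by (meson order_trans)

lemma vars_in_single: "Poly_Mapping.keys m \<subseteq> X \<Longrightarrow> vars_in X (Poly_Mapping.single m a)"
  by (simp add: vars_in_def)

text \<open>An explicit description in terms of polynomials, to which algebraic independence can be
  applied; the hull gives no such access.\<close>

definition rat_fractions :: "real set \<Rightarrow> real set" where
  "rat_fractions X = {eval_rat_poly p / eval_rat_poly q |p q. vars_in X p \<and> vars_in X q \<and> eval_rat_poly q \<noteq> 0}"

lemma rat_fractionsI:
  "vars_in X p \<Longrightarrow> vars_in X q \<Longrightarrow> eval_rat_poly q \<noteq> 0 \<Longrightarrow> x = eval_rat_poly p / eval_rat_poly q \<Longrightarrow> x \<in> rat_fractions X"
  by (auto simp: rat_fractions_def)

lemma rat_fractions_single:
  assumes "Poly_Mapping.keys m \<subseteq> X"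
  shows "of_rat a * eval_monom m \<in> rat_fractions X"
  by (rule rat_fractionsI[of X "Poly_Mapping.single m a" "Poly_Mapping.single 0 1"])
    (use assms in \<open>auto simp: vars_in_single eval_monom_def simp del: single_one\<close>)

lemma real_subfield_rat_fractions: "real_subfield (rat_fractions X)"
  unfolding real_subfield_def
proof (intro conjI ballI impI)
  show "0 \<in> rat_fractions X" "1 \<in> rat_fractions X"
    using rat_fractions_single[of 0 X 0] rat_fractions_single[of 0 X 1] by (auto simp: eval_monom_def)
next
  fix x assume "x \<in> rat_fractions X"
  then obtain p q where x: "vars_in X p" "vars_in X q" "eval_rat_poly q \<noteq> 0" "x = eval_rat_poly p / eval_rat_poly q"
    by (auto simp: rat_fractions_def)
  show "- x \<in> rat_fractions X"
    by (rule rat_fractionsI[of X "- p" q]) (use x in \<open>auto simp: vars_in_uminus eval_rat_poly_uminus\<close>)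
  show "inverse x \<in> rat_fractions X" if "x \<noteq> 0"
    by (rule rat_fractionsI[of X q p]) (use x that in auto)
  fix y assume "y \<in> rat_fractions X"
  then obtain p' q' where y: "vars_in X p'" "vars_in X q'" "eval_rat_poly q' \<noteq> 0" "y = eval_rat_poly p' / eval_rat_poly q'"
    by (auto simp: rat_fractions_def)
  show "x + y \<in> rat_fractions X"
    by (rule rat_fractionsI[of X "p * q' + p' * q" "q * q'"])
      (use x y in \<open>auto simp: vars_in_mult vars_in_add eval_rat_poly_add eval_rat_poly_mult field_simps\<close>)
  show "x * y \<in> rat_fractions X"
    by (rule rat_fractionsI[of X "p * p'" "q * q'"])
      (use x y in \<open>auto simp: vars_in_mult eval_rat_poly_mult\<close>)
qed

lemma rat_adjoin_subset_rat_fractions: "rat_adjoin X \<subseteq> rat_fractions X"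
  unfolding rat_adjoin_def
proof (rule hull_minimal[of _ _ real_subfield, OF _ real_subfield_rat_fractions])
  have "x \<in> rat_fractions X" if "x \<in> X" for x
    using rat_fractions_single[of "Poly_Mapping.single x 1" X 1] that by (simp add: eval_monom_def)
  moreover have "of_rat a \<in> rat_fractions X" for a
    using rat_fractions_single[of 0 X a] by (simp add: eval_monom_def)
  ultimately show "\<rat> \<union> X \<subseteq> rat_fractions X"
    by (auto elim!: Rats_cases)
qed

text \<open>If \<open>c\<close> outside \<open>X\<close> were p / q, then c q - p would be a
  polynomial relation on \<open>C\<close>. It is nontrivial: a monomial of \<open>q\<close>
  multiplied by \<open>c\<close> cannot cancel against \<open>p\<close>, which does not involve
  \<open>c\<close>.\<close>

lemma alg_independent_Int_rat_adjoin:
  assumes ind: "alg_independent_rat C" and "X \<subseteq> C"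
  shows "C \<inter> rat_adjoin X \<subseteq> X"
proof
  fix c assume c: "c \<in> C \<inter> rat_adjoin X"
  show "c \<in> X"
  proof (rule ccontr)
    assume "c \<notin> X"
    have "c \<in> rat_fractions X" using c rat_adjoin_subset_rat_fractions by blast
    then obtain p q where p: "vars_in X p" and q: "vars_in X q" "eval_rat_poly q \<noteq> 0"
        and "c = eval_rat_poly p / eval_rat_poly q"
      by (auto simp: rat_fractions_def)
    then have eq: "c * eval_rat_poly q = eval_rat_poly p" by simp
    let ?c = "Poly_Mapping.single c (1::nat)"
    \<comment> \<open>This is c q - p, written as a sum of monomials so that its coefficients can be
      read off.\<close>
    define r where "r = (\<Sum>m\<in>Poly_Mapping.keys q. Poly_Mapping.single (?c + m) (poly_mapping.lookup q m)) - p"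
    have "r = Poly_Mapping.single ?c 1 * q + - p"
      unfolding r_def by (subst (3) poly_mapping_sum_single[of q]) (simp add: sum_distrib_left mult_single)
    moreover have "eval_rat_poly (Poly_Mapping.single ?c 1 * q + - p) = 0"
      unfolding eval_rat_poly_add eval_rat_poly_mult eval_rat_poly_uminus eval_rat_poly_single
      using eq by (simp add: eval_monom_def)
    moreover have "vars_in C (Poly_Mapping.single ?c 1 * q + - p)"
      using c vars_in_mono[OF _ \<open>X \<subseteq> C\<close>] p q(1)
      by (intro vars_in_add vars_in_mult vars_in_uminus vars_in_single) simp_all
    ultimately have "r = 0"
      using ind unfolding alg_independent_rat_def vars_in_def by metis
    obtain m where m: "m \<in> Poly_Mapping.keys q"
      using q(2) by (force simp: eval_rat_poly_def)
    have "?c + m \<notin> Poly_Mapping.keys p"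
    proof
      assume "?c + m \<in> Poly_Mapping.keys p"
      then have "Poly_Mapping.keys (?c + m) \<subseteq> X" using p by (auto simp: vars_in_def)
      moreover have "c \<in> Poly_Mapping.keys (?c + m)" by (simp add: in_keys_iff lookup_add)
      ultimately show False using \<open>c \<notin> X\<close> by blast
    qed
    then have "poly_mapping.lookup r (?c + m) = poly_mapping.lookup q m"
      using m by (simp add: r_def lookup_minus lookup_sum lookup_single when_def in_keys_iff)
    then show False using m \<open>r = 0\<close> by (simp add: in_keys_iff)
  qed
qed

section \<open>Generating the field in countably many steps\<close>

lemma real_subfield_rat_adjoin: "real_subfield (rat_adjoin X)"
  unfolding rat_adjoin_def by (rule hull_in) (auto simp: real_subfield_def)

lemma subset_rat_adjoin: "X \<subseteq> rat_adjoin X"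
  unfolding rat_adjoin_def using hull_subset by (metis le_sup_iff)

lemma real_subfield_diff_divide:
  assumes "real_subfield K" "a \<in> K" "b \<in> K" "c \<in> K" "c \<noteq> 0"
  shows "a - b / c \<in> K"
proof -
  have "a + - (b * inverse c) \<in> K"
    using assms unfolding real_subfield_def by blast
  then show ?thesis by (simp add: divide_inverse)
qed

lemma Rats_subset_real_subfield:
  assumes K: "real_subfield K"
  shows "\<rat> \<subseteq> K"
proof
  have n: "real n \<in> K" for n
    by (induction n) (use K in \<open>auto simp: real_subfield_def\<close>)
  have z: "real_of_int z \<in> K" for z
  proof (cases z)
    case (neg m)
    have "- real (Suc m) \<in> K" using n K unfolding real_subfield_def by blast
    then show ?thesis using neg by simp
  qed (simp add: n)
  fix x :: real assume "x \<in> \<rat>"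
  then obtain a b where "b > 0" "x = of_int a / of_int b"
    by (metis Rats_cases')
  then show "x \<in> K"
    using real_subfield_diff_divide[OF K z[of 0] z[of "- a"] z[of b]] by simp
qed

lemma power_B_rat_adjoin:
  assumes U: "free_filter U" and cnt: "\<And>Z. countable Z \<Longrightarrow> bounded_wrt (le_mod U) Z"
    and X: "power_B U (X \<union> {0, 1})"
  shows "power_B U (rat_adjoin X)"
proof -
  \<comment> \<open>The single operation \<open>a - b / c\<close> generates all field operations from \<open>0\<close> and \<open>1\<close>.\<close>
  define step where "step n Y = {a - b / c |a b c. a \<in> Y \<and> b \<in> Y \<and> c \<in> Y \<and> inverse (real (Suc n)) \<le> \<bar>c\<bar>}"
    for n and Y :: "real set"
  define Y where "Y = rec_nat (X \<union> {0, 1}) step"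
  have Y0: "Y 0 = X \<union> {0, 1}" and YS: "Y (Suc n) = step n (Y n)" for n
    by (simp_all add: Y_def)
  have mono1: "0 \<in> Y n \<and> 1 \<in> Y n \<and> Y n \<subseteq> Y (Suc n)" for n
  proof (induction n)
    case 0
    have "a \<in> Y (Suc 0)" if "a \<in> Y 0" for a
      unfolding YS step_def using that
      by (intro CollectI exI[of _ a] exI[of _ 0] exI[of _ 1]) (simp add: Y0)
    then show ?case by (auto simp: Y0)
  next
    case (Suc n)
    then have 01: "0 \<in> Y (Suc n)" "1 \<in> Y (Suc n)" by auto
    have "a \<in> Y (Suc (Suc n))" if "a \<in> Y (Suc n)" for a
      unfolding YS[of "Suc n"] step_def using that 01
      by (intro CollectI exI[of _ a] exI[of _ 0] exI[of _ 1]) (simp add: field_simps)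
    then show ?case using 01 by auto
  qed
  then have mono: "Y m \<subseteq> Y n" if "m \<le> n" for m n
    using lift_Suc_mono_le[of Y m n] that by blast
  have "power_B U (Y n)" for n
  proof (induction n)
    case (Suc n)
    then show ?case unfolding YS step_def by (rule power_B_quotients) simp
  qed (simp only: Y0 X)
  then have "power_B U (\<Union>n. Y n)"
    using mono1 by (intro power_B_UN[OF U cnt]) auto
  moreover have "(\<Union>n. Y n) = rat_adjoin X"
  proof
    have K: "real_subfield (rat_adjoin X)" by (rule real_subfield_rat_adjoin)
    have "Y n \<subseteq> rat_adjoin X" for n
    proof (induction n)
      case 0
      then show ?case using subset_rat_adjoin K by (auto simp: Y0 real_subfield_def)
    next
      case (Suc n)
      have "c \<noteq> 0" if "inverse (real (Suc n)) \<le> \<bar>c\<bar>" for c :: real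
        using that by (auto simp del: of_nat_Suc)
      then show ?case
        using Suc real_subfield_diff_divide[OF K] unfolding YS step_def by blast
    qed
    then show "(\<Union>n. Y n) \<subseteq> rat_adjoin X" by blast
    have op: "a - b / c \<in> (\<Union>n. Y n)" if "a \<in> (\<Union>n. Y n)" "b \<in> (\<Union>n. Y n)" "c \<in> (\<Union>n. Y n)" "c \<noteq> 0" for a b c
    proof -
      obtain na nb nc where n: "a \<in> Y na" "b \<in> Y nb" "c \<in> Y nc" using \<open>a \<in> _\<close> \<open>b \<in> _\<close> \<open>c \<in> _\<close> by blast
      obtain nd where nd: "inverse (real (Suc nd)) < \<bar>c\<bar>"
        using reals_Archimedean[of "\<bar>c\<bar>"] \<open>c \<noteq> 0\<close> by auto
      \<comment> \<open>A stage containing all three operands at which the admissible denominators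
        already include \<open>c\<close>.\<close>
      define N where "N = Max {na, nb, nc, nd}"
      have N: "na \<le> N" "nb \<le> N" "nc \<le> N" "nd \<le> N" by (auto simp: N_def)
      have "inverse (real (Suc N)) \<le> inverse (real (Suc nd))"
        using N(4) by (intro le_imp_inverse_le) auto
      then have "inverse (real (Suc N)) \<le> \<bar>c\<bar>" using nd by linarith
      moreover have "a \<in> Y N" "b \<in> Y N" "c \<in> Y N" using n mono N by blast+
      ultimately have "a - b / c \<in> Y (Suc N)"
        unfolding YS step_def by blast
      then show ?thesis by blast
    qed
    have 0: "0 \<in> (\<Union>n. Y n)" and 1: "1 \<in> (\<Union>n. Y n)" using mono1 by auto
    have neg: "- a \<in> (\<Union>n. Y n)" if "a \<in> (\<Union>n. Y n)" for a
      using op[OF 0 that 1] by simp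
    have add: "a + b \<in> (\<Union>n. Y n)" if "a \<in> (\<Union>n. Y n)" "b \<in> (\<Union>n. Y n)" for a b
      using op[OF that(1) neg[OF that(2)] 1] by simp
    have inv: "inverse a \<in> (\<Union>n. Y n)" if "a \<in> (\<Union>n. Y n)" "a \<noteq> 0" for a
      using op[OF 0 neg[OF 1] that] by (simp add: inverse_eq_divide)
    \<comment> \<open>For nonzero \<open>b\<close> the product is 0 - (-a) / (inverse b).\<close>
    have mult: "a * b \<in> (\<Union>n. Y n)" if "a \<in> (\<Union>n. Y n)" "b \<in> (\<Union>n. Y n)" for a b
    proof (cases "b = 0")
      case False
      then show ?thesis using op[OF 0 neg[OF that(1)] inv[OF that(2)]] by (simp add: divide_inverse)
    qed (use 0 in simp)
    have "real_subfield (\<Union>n. Y n)"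
      unfolding real_subfield_def by (intro conjI ballI impI 0 1 neg add inv mult)
    moreover from this have "\<rat> \<union> X \<subseteq> (\<Union>n. Y n)"
      using Rats_subset_real_subfield Y0 by blast
    ultimately show "rat_adjoin X \<subseteq> (\<Union>n. Y n)"
      unfolding rat_adjoin_def by (rule hull_minimal[of _ _ real_subfield, rotated])
  qed
  ultimately show ?thesis by simp
qed

section \<open>Failure of the Hurewicz property\<close>

text \<open>A run \<open>{n..g n}\<close> in the range of \<open>f\<close> forces the first missing
  number from \<open>n\<close> on to exceed \<open>g n\<close>, so no \<open>g\<close> bounds this
  function almost everywhere.\<close>

lemma not_Hurewicz_if_runs:
  fixes C Y :: "real set" and e :: "real \<Rightarrow> nat \<Rightarrow> enat"
  assumes C: "closed C" and e: "continuous_on C e"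
    and c: "\<And>y j. y \<in> Y \<Longrightarrow> (y - c) * 2 ^ j \<notin> \<int>"
    and gap: "\<And>y n. y \<in> Y \<Longrightarrow> y \<in> C \<Longrightarrow> \<exists>k\<ge>n. \<forall>i\<le>k. e y i \<noteq> enat k"
    and runs: "\<And>g. \<exists>y\<in>Y \<inter> C. \<exists>f. strict_mono f \<and> e y = enat_seq f \<and> (\<exists>\<^sub>\<infinity>n. {n..g n} \<subseteq> range f)"
  shows "\<not> Hurewicz (top_of_set Y)"
proof
  assume H: "Hurewicz (top_of_set Y)"
  \<comment> \<open>On \<open>Y \<inter> C\<close> the function \<open>\<psi> y n\<close> below bounds the first \<open>k \<ge> n\<close> outside the range of \<open>e y\<close>. It only
    depends on the dyadic intervals around \<open>c\<close> containing \<open>y\<close>, whose endpoints avoid \<open>Y\<close>; off \<open>C\<close> the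
    condition \<open>R\<close> eventually holds vacuously.\<close>
  define R where "R y n j \<longleftrightarrow> (\<forall>x\<in>C. \<lfloor>(x - c) * 2 ^ j\<rfloor> = \<lfloor>(y - c) * 2 ^ j\<rfloor> \<longrightarrow>
      (\<exists>k\<in>{n..j}. \<forall>i\<le>k. e x i \<noteq> enat k))" for y n j
  define \<psi> where "\<psi> y n = (LEAST j. R y n j)" for y n
  have exR: "\<exists>j. R y n j" if y: "y \<in> Y" for y n
  proof -
    have "\<exists>k\<ge>n. \<exists>\<delta>>0. \<forall>x\<in>C. dist x y < \<delta> \<longrightarrow> (\<forall>i\<le>k. e x i \<noteq> enat k)"
    proof (cases "y \<in> C")
      case True
      then obtain k where k: "k \<ge> n" "\<forall>i\<le>k. e y i \<noteq> enat k" using gap y by blast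
      \<comment> \<open>Only the finitely many indices up to \<open>k\<close> are tested, so the
        condition holds on a neighborhood. For an increasing \<open>f\<close> this suffices, as f i
        \<ge> i.\<close>
      have "\<forall>\<^sub>F x in at y within C. e x i \<noteq> enat k" if "i \<le> k" for i
      proof -
        have "((\<lambda>x. e x i) \<longlongrightarrow> e y i) (at y within C)"
          using continuous_on_product_then_coordinatewise[OF e] True by (simp add: continuous_on_def)
        then show ?thesis
          using k(2) that by (intro tendsto_imp_eventually_ne) auto
      qed
      then have "\<forall>\<^sub>F x in at y within C. \<forall>i\<in>{..k}. e x i \<noteq> enat k"
        by (simp add: eventually_ball_finite_distrib)
      then obtain \<delta> where "\<delta> > 0" "\<And>x. x \<in> C \<Longrightarrow> x \<noteq> y \<Longrightarrow> dist x y < \<delta> \<Longrightarrow> \<forall>i\<in>{..k}. e x i \<noteq> enat k"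
        unfolding eventually_at by blast
      then show ?thesis using k by (metis atMost_iff)
    next
      case False
      then obtain \<delta> where "\<delta> > 0" "ball y \<delta> \<subseteq> - C"
        using C by (meson ComplI open_Compl open_contains_ball)
      then have "\<forall>x\<in>C. \<not> dist x y < \<delta>" by (auto simp: subset_iff dist_commute)
      then show ?thesis using \<open>\<delta> > 0\<close> by blast
    qed
    then obtain k \<delta> where k: "k \<ge> n" "\<delta> > 0" "\<forall>x\<in>C. dist x y < \<delta> \<longrightarrow> (\<forall>i\<le>k. e x i \<noteq> enat k)"
      by blast
    obtain j0 where j0: "(1 / 2 :: real) ^ j0 < \<delta>"
      using real_arch_pow_inv[of \<delta> "1 / 2"] k(2) by auto
    \<comment> \<open>Large enough for two purposes: the dyadic intervals are shorter than \<delta>,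
      and \<open>k\<close> lies in \<open>{n..j}\<close>.\<close>
    define j where "j = max j0 k"
    have "(1 / 2 :: real) ^ j \<le> (1 / 2) ^ j0"
      by (rule power_decreasing) (auto simp: j_def)
    then have j: "(1 / 2 :: real) ^ j < \<delta>" using j0 by (rule le_less_trans)
    have "R y n j"
      unfolding R_def
    proof (intro ballI impI)
      fix x assume x: "x \<in> C" "\<lfloor>(x - c) * 2 ^ j\<rfloor> = \<lfloor>(y - c) * 2 ^ j\<rfloor>"
      have "\<bar>(x - c) * 2 ^ j - (y - c) * 2 ^ j\<bar> < 1"
        using x(2) by linarith
      then have "\<bar>x - y\<bar> * 2 ^ j < 1"
        by (simp add: left_diff_distrib[symmetric] abs_mult)
      then have "dist x y < (1 / 2) ^ j"
        by (simp add: dist_real_def field_simps)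
      then show "\<exists>k\<in>{n..j}. \<forall>i\<le>k. e x i \<noteq> enat k"
        using k x(1) j by (intro bexI[of _ k]) (auto simp: j_def)
    qed
    then show ?thesis ..
  qed
  have "continuous_on Y \<psi>"
  proof (rule continuous_on_coordinatewise_then_product)
    fix n
    show "continuous_on Y (\<lambda>y. \<psi> y n)"
      unfolding continuous_on_def
    proof
      fix y assume y: "y \<in> Y"
      \<comment> \<open>The floor function is locally constant away from the integers, and only
        finitely many \<open>j\<close> matter.\<close>
      have "\<forall>\<^sub>F z in at y within Y. \<forall>j\<in>{..\<psi> y n}. \<lfloor>(z - c) * 2 ^ j\<rfloor> = \<lfloor>(y - c) * 2 ^ j\<rfloor>"
        unfolding eventually_ball_finite_distrib[OF finite_atMost]
        by (intro ballI eventually_floor_eq tendsto_intros c y)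
      then have "\<forall>\<^sub>F z in at y within Y. \<psi> z n = \<psi> y n"
      proof (rule eventually_mono)
        fix z assume z: "\<forall>j\<in>{..\<psi> y n}. \<lfloor>(z - c) * 2 ^ j\<rfloor> = \<lfloor>(y - c) * 2 ^ j\<rfloor>"
        then have Rz: "R z n j \<longleftrightarrow> R y n j" if "j \<le> \<psi> y n" for j
          using that by (simp add: R_def)
        show "\<psi> z n = \<psi> y n"
          unfolding \<psi>_def[of z]
        proof (rule Least_equality)
          show "R z n (\<psi> y n)"
            using Rz LeastI_ex[OF exR[OF y]] by (simp add: \<psi>_def)
          show "\<psi> y n \<le> j" if "R z n j" for j
            using that Rz[of j] Least_le[of "R y n" j] by (cases "j \<le> \<psi> y n") (auto simp: \<psi>_def)
        qed
      qed
      then show "((\<lambda>y. \<psi> y n) \<longlongrightarrow> \<psi> y n) (at y within Y)"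
        by (rule tendsto_eventually)
    qed
  qed
  then obtain g where g: "\<And>y. y \<in> Y \<Longrightarrow> le_star (\<psi> y) g"
    using H unfolding Hurewicz_def bounded_wrt_def by force
  obtain y f where y: "y \<in> Y" "y \<in> C" and f: "strict_mono f" "e y = enat_seq f"
    and inf: "\<exists>\<^sub>\<infinity>n. {n..g n} \<subseteq> range f"
    using runs[of g] by auto
  obtain N where N: "\<And>n. n \<ge> N \<Longrightarrow> \<psi> y n \<le> g n"
    using g[OF y(1)] unfolding le_star_def MOST_nat_le by blast
  obtain n where n: "n \<ge> N" "{n..g n} \<subseteq> range f"
    using inf unfolding INFM_nat_le by blast
  have "R y n (\<psi> y n)"
    unfolding \<psi>_def by (rule LeastI_ex[OF exR[OF y(1)]])
  then obtain k where k: "k \<in> {n..\<psi> y n}" "\<forall>i\<le>k. e y i \<noteq> enat k"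
    using y(2) unfolding R_def by blast
  then have "k \<in> range f" using N[OF n(1)] n(2) by fastforce
  then obtain i where "k = f i" by blast
  then show False
    using k(2) strict_mono_imp_increasing[OF f(1), of i] f(2) by (auto simp: enat_seq_def)
qed

section \<open>The Cantor space and the set Q\<close>

lemma compact_UNIV_nat_bool: "compact (UNIV :: (nat \<Rightarrow> bool) set)"
proof -
  have "compactin (product_topology (\<lambda>_::nat. euclidean :: bool topology) UNIV) (PiE UNIV (\<lambda>_. UNIV))"
    unfolding compactin_PiE by (simp add: finite_imp_compact)
  then show ?thesis by (simp add: euclidean_product_topology)
qed

lemma enat_seq_in_enat_incr: "strict_mono f \<Longrightarrow> enat_seq f \<in> enat_incr"
  by (auto simp: enat_incr_def enat_seq_def mono_def strict_mono_less_eq strict_mono_less)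

lemma Q_set_infinite_tail:
  assumes "q \<in> Q_set"
  shows "\<exists>n. \<forall>i\<ge>n. q i = \<infinity>"
proof -
  obtain n where "q n = \<infinity>" and "mono q"
    using assms by (auto simp: Q_set_def enat_incr_def)
  then have "q i = \<infinity>" if "i \<ge> n" for i
    using monoD[OF \<open>mono q\<close> that] by simp
  then show ?thesis by blast
qed

text \<open>A member of \<open>Q_set\<close> is determined by the finite list of its values before
  the infinite tail.\<close>

lemma countable_Q_set: "countable Q_set"
proof -
  have "q \<in> (\<lambda>xs i. if i < length xs then xs ! i else \<infinity>) ` (UNIV :: enat list set)" if q: "q \<in> Q_set" for q
  proof -
    obtain n where "\<forall>i\<ge>n. q i = \<infinity>" using Q_set_infinite_tail[OF q] by blast
    then have "q = (\<lambda>i. if i < length (map q [0..<n]) then map q [0..<n] ! i else \<infinity>)"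
      by (auto simp: fun_eq_iff)
    then show ?thesis by blast
  qed
  then have "Q_set \<subseteq> (\<lambda>xs i. if i < length xs then xs ! i else \<infinity>) ` (UNIV :: enat list set)" by blast
  then show ?thesis by (rule countable_subset) simp
qed

lemma Q_set_gap:
  assumes "q \<in> Q_set"
  shows "\<exists>k\<ge>n. \<forall>i. q i \<noteq> enat k"
proof -
  obtain N where N: "\<forall>i\<ge>N. q i = \<infinity>" using Q_set_infinite_tail[OF assms] by blast
  \<comment> \<open>This exceeds \<open>n\<close> and every finite value; an infinite value before
    \<open>N\<close> contributes some natural number, which does no harm.\<close>
  let ?k = "Suc (n + (\<Sum>i<N. the_enat (q i)))"
  have "q i \<noteq> enat ?k" for i
  proof
    assume i: "q i = enat ?k"
    then have "i < N" using N by (metis enat.distinct(1) not_le)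
    then have "the_enat (q i) \<le> (\<Sum>i<N. the_enat (q i))"
      by (intro member_le_sum) auto
    then show False using i by simp
  qed
  then show ?thesis by (intro exI[of _ ?k]) auto
qed

section \<open>Verification for the constructed ultrafilter and scale\<close>

theorem theorem6p3:
  fixes C :: "real set"
    and h :: "(nat \<Rightarrow> enat) \<Rightarrow> real"
    and h' :: "real \<Rightarrow> nat \<Rightarrow> enat"
  assumes "C homeomorphic (UNIV :: (nat \<Rightarrow> bool) set)"
    and "alg_independent_rat C"
    and "homeomorphism enat_incr C h h'"
    and "regularCard card_d"
  shows "\<exists>U f. free_ultrafilter U \<and> card_b U =o card_d \<and> b_scale U card_d f \<and>
    (let S = f ` Field card_d;
         X = h ` (enat_seq ` S \<union> Q_set)
     in (\<forall>k. satisfies_B U (finite_power (top_of_set X) k)) \<and>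
        \<not> Hurewicz (top_of_set X) \<and>
        (\<forall>k. Menger (finite_power (top_of_set (rat_adjoin X)) k)) \<and>
        \<not> Hurewicz (top_of_set (rat_adjoin X)))"
proof -
  let ?I = "Field card_d"
  obtain U f where ultra: "free_ultrafilter U" "\<And>B. B \<in> U \<or> - B \<in> U"
    and f: "\<And>x. x \<in> ?I \<Longrightarrow> strict_mono (f x)"
    and gap: "\<And>x n. x \<in> ?I \<Longrightarrow> \<exists>k\<ge>n. k \<notin> range (f x)"
    and runs: "\<And>x. x \<in> ?I \<Longrightarrow> \<exists>\<^sub>\<infinity>n. {n..x n} \<subseteq> range (f x)"
    and dom: "\<And>x y. (y, x) \<in> card_d \<Longrightarrow> le_mod U y (f x)"
    and scale: "\<And>x y. (y, x) \<in> card_d \<Longrightarrow> y \<noteq> x \<Longrightarrow> le_mod U (f y) (f x)"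
    by (rule exists_ultrafilter_with_scale[OF assms(4)]) blast
  have U: "free_filter U" using ultra(1) by (rule free_ultrafilter_imp_free_filter)
  have small: "bounded_wrt (le_mod U) Y" if "|Y| <o card_d" for Y
    using bounded_le_mod_if_small[OF assms(4) U dom that] .
  have cnt: "bounded_wrt (le_mod U) Y" if "countable Y" for Y
    using small[OF countable_ordLess_card_d[OF that]] .
  have b: "card_b U =o card_d" using card_b_eq_card_d[OF U small] .
  have unb: "\<not> bounded_wrt (le_mod U) (f ` ?I)"
  proof
    assume "bounded_wrt (le_mod U) (f ` ?I)"
    then obtain g where g: "\<And>x. x \<in> ?I \<Longrightarrow> le_mod U (f x) g" by (auto simp: bounded_wrt_def)
    have "Well_order card_d" using Card_order_card_d card_order_on_well_order_on by blast
    then have "refl_on ?I card_d"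
      by (auto simp: well_order_on_def linear_order_on_def partial_order_on_def preorder_on_def)
    \<comment> \<open>By reflexivity each index function lies below its own \<open>f x\<close>; the
      index functions are dominating, so a bound for the scale would bound a dominating
      family.\<close>
    then have "le_mod U x g" if "x \<in> ?I" for x
      using dom g that le_mod_trans[OF U] by (meson refl_onD)
    then show False
      using dominating_imp_unbounded_le_mod[OF U dominating_Field_card_d] by (auto simp: bounded_wrt_def)
  qed
  have bs: "b_scale U card_d f"
    unfolding b_scale_def using ordIso_symmetric[OF b] f unb scale by blast
  define X where "X = h ` (enat_seq ` (f ` ?I) \<union> Q_set)"
  have C: "compact C"
    using homeomorphic_compactness[OF assms(1)] compact_UNIV_nat_bool by simp
  have h': "continuous_on C h'" and hC: "\<And>q. q \<in> enat_incr \<Longrightarrow> h q \<in> C" "\<And>c. c \<in> C \<Longrightarrow> h' c \<in> enat_incr"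
    and inv: "\<And>c. c \<in> C \<Longrightarrow> h (h' c) = c" "\<And>q. q \<in> enat_incr \<Longrightarrow> h' (h q) = q"
    using assms(3) by (auto simp: homeomorphism_def)
  have QI: "Q_set \<subseteq> enat_incr" by (auto simp: Q_set_def)
  have fI: "enat_seq (f x) \<in> enat_incr" if "x \<in> ?I" for x
    using enat_seq_in_enat_incr[OF f[OF that]] .
  have XC: "X \<subseteq> C" using fI QI hC by (auto simp: X_def)
  \<comment> \<open>The parameter \<open>D\<close> serves both \<open>X\<close> itself and
    \<open>X\<close> with 0 and 1 added.\<close>
  have pow: "power_B U (h ` Q_set \<union> D \<union> (\<lambda>x. h (enat_seq (f x))) ` ?I)" if "countable D" for D
  proof (rule power_B_scale[OF U ultra(2) small unb scale C h'])
    show "{c \<in> C. \<exists>n. h' c n = \<infinity>} \<subseteq> h ` Q_set \<union> D"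
    proof
      fix c assume "c \<in> {c \<in> C. \<exists>n. h' c n = \<infinity>}"
      then have "h' c \<in> Q_set" "c = h (h' c)"
        using hC(2) inv(1) by (auto simp: Q_set_def)
      then show "c \<in> h ` Q_set \<union> D" by blast
    qed
    show "|h ` Q_set \<union> D| <o card_d"
      using that countable_Q_set by (intro countable_ordLess_card_d) auto
  qed (use hC fI inv in auto)
  have X: "X = h ` Q_set \<union> {} \<union> (\<lambda>x. h (enat_seq (f x))) ` ?I" by (auto simp: X_def)
  have "power_B U X" unfolding X by (rule pow) simp
  have "X \<union> {0, 1} = h ` Q_set \<union> {0, 1} \<union> (\<lambda>x. h (enat_seq (f x))) ` ?I" by (auto simp: X)
  then have "power_B U (X \<union> {0, 1})" using pow[of "{0, 1}"] by simp
  then have "power_B U (rat_adjoin X)" using power_B_rat_adjoin[OF U] cnt by blast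
  \<comment> \<open>The identity omits no number, whereas members of the scale and of
    \<open>Q_set\<close> do; hence \<open>c\<close> lies outside \<open>X\<close>, and by
    independence outside the generated field.\<close>
  define c where "c = h (enat_seq (\<lambda>n. n))"
  have idI: "enat_seq (\<lambda>n. n) \<in> enat_incr" by (rule enat_seq_in_enat_incr) (simp add: strict_mono_def)
  then have "c \<in> C" by (simp add: c_def hC)
  have "c \<notin> X"
  proof
    assume "c \<in> X"
    then obtain q where q: "q \<in> enat_seq ` (f ` ?I) \<union> Q_set" "c = h q" by (auto simp: X_def)
    then have qI: "q \<in> enat_incr" using fI QI by blast
    have "h q = h (enat_seq (\<lambda>n. n))" using q(2) by (simp only: c_def)
    from arg_cong[OF this, of h'] have "q = enat_seq (\<lambda>n. n)"
      unfolding inv(2)[OF idI] inv(2)[OF qI] .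
    then have qi: "q i = enat i" for i by (simp add: enat_seq_def)
    from q(1) show False
    proof
      assume "q \<in> enat_seq ` (f ` ?I)"
      then obtain x where x: "x \<in> ?I" "q = enat_seq (f x)" by blast
      then have "f x i = i" for i using qi[of i] by (simp add: enat_seq_def)
      then show False using gap[OF x(1), of 0] by (metis rangeI)
    next
      assume "q \<in> Q_set"
      then show False using Q_set_gap[of q 0] qi by blast
    qed
  qed
  have "X \<subseteq> rat_adjoin X" by (rule subset_rat_adjoin)
  have adj: "C \<inter> rat_adjoin X \<subseteq> X"
    using alg_independent_Int_rat_adjoin[OF assms(2) XC] .
  have K: "real_subfield (rat_adjoin X)" by (rule real_subfield_rat_adjoin)
  \<comment> \<open>The argument works for every \<open>Y\<close> between \<open>X\<close> and the
    field, since such a \<open>Y\<close> meets \<open>C\<close> exactly in \<open>X\<close>.\<close>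
  have nonH: "\<not> Hurewicz (top_of_set Y)" if Y: "X \<subseteq> Y" "Y \<subseteq> rat_adjoin X" for Y
  proof (rule not_Hurewicz_if_runs[OF compact_imp_closed[OF C] h', where c = c])
    fix y and j :: nat assume "y \<in> Y"
    show "(y - c) * 2 ^ j \<notin> \<int>"
    proof
      assume "(y - c) * 2 ^ j \<in> \<int>"
      then obtain z where "(y - c) * 2 ^ j = of_int z" by (elim Ints_cases)
      then have "c = y - of_int z / 2 ^ j" by (simp add: field_simps)
      moreover have "of_int z \<in> rat_adjoin X" "2 ^ j \<in> rat_adjoin X" "y \<in> rat_adjoin X"
        using Rats_subset_real_subfield[OF K] Y(2) \<open>y \<in> Y\<close> by auto
      ultimately have "c \<in> rat_adjoin X"
        using real_subfield_diff_divide[OF K] by simp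
      then show False using adj \<open>c \<in> C\<close> \<open>c \<notin> X\<close> by blast
    qed
  next
    fix y n assume "y \<in> Y" "y \<in> C"
    then have "y \<in> X" using adj Y(2) by blast
    then consider q where "q \<in> Q_set" "y = h q" | x where "x \<in> ?I" "y = h (enat_seq (f x))"
      by (auto simp: X_def)
    then show "\<exists>k\<ge>n. \<forall>i\<le>k. h' y i \<noteq> enat k"
    proof cases
      case 1
      then have "h' y = q" using QI inv(2) by blast
      then show ?thesis using Q_set_gap[OF 1(1), of n] by blast
    next
      case 2
      obtain k where "k \<ge> n" "k \<notin> range (f x)" using gap[OF 2(1)] by blast
      then show ?thesis using inv(2)[OF fI[OF 2(1)]] 2(2) by (auto simp: enat_seq_def)
    qed
  next
    fix g
    \<comment> \<open>An index function above \<open>g\<close> almost everywhere: the runs of length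
      prescribed by \<open>x\<close> then contain those prescribed by \<open>g\<close>.\<close>
    obtain x where x: "x \<in> ?I" "le_star g x"
      using dominating_Field_card_d by (auto simp: dominating_def)
    have "\<exists>\<^sub>\<infinity>n. {n..x n} \<subseteq> range (f x)" using runs[OF x(1)] .
    then have "\<exists>\<^sub>\<infinity>n. {n..g n} \<subseteq> range (f x)"
      by (rule frequently_rev_mp) (rule eventually_mono[OF x(2)[unfolded le_star_def]],
          metis atLeastatMost_subset_iff order_refl order_trans)
    moreover have "h (enat_seq (f x)) \<in> Y \<inter> C"
      using Y(1) x(1) hC(1)[OF fI[OF x(1)]] by (auto simp: X_def)
    ultimately show "\<exists>y\<in>Y \<inter> C. \<exists>k. strict_mono k \<and> h' y = enat_seq k \<and> (\<exists>\<^sub>\<infinity>n. {n..g n} \<subseteq> range k)"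
      using f[OF x(1)] inv(2)[OF fI[OF x(1)]] by blast
  qed
  show ?thesis
  proof (intro exI[of _ U] exI[of _ f] conjI ultra(1) b bs)
    show "let S = f ` Field card_d;
         X = h ` (enat_seq ` S \<union> Q_set)
     in (\<forall>k. satisfies_B U (finite_power (top_of_set X) k)) \<and>
        \<not> Hurewicz (top_of_set X) \<and>
        (\<forall>k. Menger (finite_power (top_of_set (rat_adjoin X)) k)) \<and>
        \<not> Hurewicz (top_of_set (rat_adjoin X))"
      unfolding Let_def X_def[symmetric]
      using power_B_imp_satisfies_B[OF \<open>power_B U X\<close>] nonH[of X] nonH[of "rat_adjoin X"]
        satisfies_B_imp_Menger[OF U power_B_imp_satisfies_B[OF \<open>power_B U (rat_adjoin X)\<close>]]
        \<open>X \<subseteq> rat_adjoin X\<close>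
      by blast
  qed
qed

end
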